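(* Let $n\ge 0$ and $\Phi\in\mathrm{End}(\mathcal{Q})$, and suppose that the numbers $c_{\alpha,(n)}$, $\alpha\in\operatorname{Comp}(n)$, are nonnegative and not all zero. Then $\lambda^n>0$, the matrix $\overline{K}=(\overline{K}(\alpha,\beta))_{\alpha,\beta\in\operatorname{Comp}(n)}$ is stochastic (nonnegative entries, every row summing to $1$), and $\overline{K}$ lumps $K$ by descent sets: for every $\beta\in\operatorname{Comp}(n)$ and all $\pi,\tau\in\mathfrak{S}_n$ with $D(\pi)=D(\tau)$, $$\sum_{\sigma\in\mathfrak{S}_n:\,D(\sigma)=\beta}K(\pi,\sigma)=\sum_{\sigma\in\mathfrak{S}_n:\,D(\sigma)=\beta}K(\tau,\sigma),$$ and this common value equals $\overline{K}(D(\pi),\beta)$.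
   Context: Work over $\mathbb{Q}$. A composition of $n\ge0$ is a sequence $\alpha=(a_1,\dots,a_k)$ of positive integers with sum $n$; $\operatorname{Comp}(n)$ is the set of them, $(n)$ is the one-part composition and $(1^n)$ the composition with $n$ parts equal to $1$. Put $S_\alpha=\{a_1,a_1+a_2,\dots,a_1+\dots+a_{k-1}\}\subseteq[n-1]$; $\alpha\mapsto S_\alpha$ is a bijection onto subsets of $[n-1]$ with inverse $S\mapsto \operatorname{co}(S)$. Order $\operatorname{Comp}(n)$ by $\alpha\le\beta$ iff $S_\alpha\subseteq S_\beta$. The monomial quasisymmetric function is $M_\alpha=\sum_{i_1<\dots<i_k}x_{i_1}^{a_1}\cdots x_{i_k}^{a_k}$; $\mathcal{Q}_n$ is the span of $\{M_\alpha\}_{\alpha\in\operatorname{Comp}(n)}$ and $\mathcal{Q}=\bigoplus_n\mathcal{Q}_n$ is a graded Hopf algebra with the usual product of power series and coproduct $\Delta(M_\alpha)=\sum_{\alpha=\beta\cdot\gamma}M_\beta\otimes M_\gamma$ (sum over ways of writing $\alpha$ as a concatenation of two possibly empty compositions). The fundamental quasisymmetric functions are $F_\alpha=\sum_{\beta\ge\alpha}M_\beta$. $\mathrm{End}(\mathcal{Q})$ denotes the set of (graded) Hopf algebra endomorphisms of $\mathcal{Q}$. For $\sigma\in\mathfrak{S}_n$ (written $(\sigma_1,\dots,\sigma_n)$, $\sigma_i=\sigma(i)$, product = composition of maps), $\operatorname{Des}(\sigma)=\{i\in[n-1]:\sigma_i>\sigma_{i+1}\}$ and $D(\sigma)=\operatorname{co}(\operatorname{Des}(\sigma))$.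 For $\Phi\in\mathrm{End}(\mathcal{Q})$ define $c_{\alpha,\beta}$ ($\alpha,\beta\in\operatorname{Comp}(n)$) by $\Phi(F_\alpha)=\sum_\beta c_{\alpha,\beta}F_\beta$, and $\lambda$ by $\Phi(M_{(1)})=\lambda M_{(1)}$. When the $c_{\alpha,(n)}$ are nonnegative and not all zero, define the probability distribution $\mathrm{Prob}_\Phi(\pi)=c_{D(\pi),(n)}/\sum_{\sigma\in\mathfrak{S}_n}c_{D(\sigma),(n)}$ on $\mathfrak{S}_n$, and the $\mathfrak{S}_n\times\mathfrak{S}_n$ matrix $K$ by $K(\pi,\sigma\pi)=\mathrm{Prob}_\Phi(\sigma^{-1})$. When $\lambda\neq0$, define $\overline{K}(\alpha,\beta)=c_{\alpha,\beta}/\lambda^n$. *)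

theory Defs
  imports
    Complex_Main
    "HOL-Library.Poly_Mapping"
    "HOL-Library.FuncSet"
    "HOL-Combinatorics.Permutations"
begin

section \<open>Formal power series over the rationals in arbitrarily many variables\<close>

text \<open>Variables are indexed by \<^typ>\<open>'v\<close>; a monomial is a finitely supported exponent vector.\<close>

typedef 'v series = "UNIV :: (('v \<Rightarrow>\<^sub>0 nat) \<Rightarrow> rat) set"
  morphisms coef Series by simp

setup_lifting type_definition_series

lemma series_eqI: "(\<And>m. coef f m = coef g m) \<Longrightarrow> f = g"
  by transfer auto

lemma finite_divisors: "finite {a :: 'v \<Rightarrow>\<^sub>0 nat. \<exists>b. a + b = m}"
proof -
  let ?B = "{..Max (insert 0 (Poly_Mapping.lookup m ` Poly_Mapping.keys m))}"
  let ?F = "{h. \<forall>x. (x \<in> Poly_Mapping.keys m \<longrightarrow> h x \<in> ?B) \<and> (x \<notin> Poly_Mapping.keys m \<longrightarrow> h x = (0::nat))}"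
  have "finite ?F"
    by (rule finite_set_of_finite_funs) auto
  moreover have "Poly_Mapping.lookup ` {a. \<exists>b. a + b = m} \<subseteq> ?F"
  proof (clarsimp, intro conjI impI)
    fix a b x
    assume m: "m = a + b"
    { assume "x \<in> Poly_Mapping.keys (a + b)"
      then have "Poly_Mapping.lookup (a + b) x \<le> Max (insert 0 (Poly_Mapping.lookup (a + b) ` Poly_Mapping.keys (a + b)))"
        by (intro Max_ge) auto
      then show "Poly_Mapping.lookup a x \<le> Max (insert 0 (Poly_Mapping.lookup (a + b) ` Poly_Mapping.keys (a + b)))"
        by (simp add: lookup_add) }
    { assume "x \<notin> Poly_Mapping.keys (a + b)"
      then show "Poly_Mapping.lookup a x = 0"
        by (simp add: in_keys_iff lookup_add) }
  qed
  ultimately have "finite (Poly_Mapping.lookup ` {a. \<exists>b. a + b = m})"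
    by (rule rev_finite_subset)
  then show ?thesis
    by (rule finite_imageD) (simp add: inj_on_def Poly_Mapping.lookup_inject)
qed

lemma finite_splits: "finite {(a, b :: 'v \<Rightarrow>\<^sub>0 nat). a + b = m}"
proof (rule finite_subset)
  show "{(a, b). a + b = m} \<subseteq> {a. \<exists>b. a + b = m} \<times> {a. \<exists>b. a + b = m}"
    by (auto intro: add.commute)
qed (intro finite_cartesian_product finite_divisors)

instantiation series :: (type) comm_ring_1
begin

lift_definition zero_series :: "'v series" is "\<lambda>m. 0" .
lift_definition one_series :: "'v series" is "\<lambda>m. if m = 0 then 1 else 0" .
lift_definition plus_series :: "'v series \<Rightarrow> 'v series \<Rightarrow> 'v series" is "\<lambda>f g m. f m + g m" .
lift_definition minus_series :: "'v series \<Rightarrow> 'v series \<Rightarrow> 'v series" is "\<lambda>f g m. f m - g m" .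
lift_definition uminus_series :: "'v series \<Rightarrow> 'v series" is "\<lambda>f m. - f m" .
lift_definition times_series :: "'v series \<Rightarrow> 'v series \<Rightarrow> 'v series"
  is "\<lambda>f g m. \<Sum>(a, b) \<in> {(a, b). a + b = m}. f a * g b" .

instance
proof
  fix f g h :: "'v series"
  show "f * g * h = f * (g * h)"
  proof (rule series_eqI)
    fix m :: "'v \<Rightarrow>\<^sub>0 nat"
    have "coef (f * g * h) m =
      (\<Sum>p\<in>{(d, c). d + c = m}. \<Sum>q\<in>{(a, b). a + b = fst p}. coef f (fst q) * coef g (snd q) * coef h (snd p))"
      by (simp add: times_series.rep_eq sum_distrib_right case_prod_unfold)
    also have "\<dots> = (\<Sum>(p, q)\<in>Sigma {(d, c). d + c = m} (\<lambda>p. {(a, b). a + b = fst p}).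
        coef f (fst q) * coef g (snd q) * coef h (snd p))"
      by (rule sum.Sigma) (auto intro: finite_splits)
    also have "\<dots> = (\<Sum>(p, q)\<in>Sigma {(a, d). a + d = m} (\<lambda>p. {(b, c). b + c = snd p}).
        coef f (fst p) * (coef g (fst q) * coef h (snd q)))"
      by (rule sum.reindex_bij_witness
            [where i = "\<lambda>(p, q). ((fst p + fst q, snd q), (fst p, fst q))"
               and j = "\<lambda>(p, q). ((fst q, snd q + snd p), (snd q, snd p))"])
         (auto simp: ac_simps)
    also have "\<dots> = (\<Sum>p\<in>{(a, d). a + d = m}. \<Sum>q\<in>{(b, c). b + c = snd p}.
        coef f (fst p) * (coef g (fst q) * coef h (snd q)))"
      by (rule sum.Sigma [symmetric]) (auto intro: finite_splits)
    also have "\<dots> = coef (f * (g * h)) m"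
      by (simp add: times_series.rep_eq sum_distrib_left case_prod_unfold)
    finally show "coef (f * g * h) m = coef (f * (g * h)) m" .
  qed
  show "f * g = g * f"
  proof (rule series_eqI)
    fix m :: "'v \<Rightarrow>\<^sub>0 nat"
    show "coef (f * g) m = coef (g * f) m"
      unfolding times_series.rep_eq
      by (rule sum.reindex_bij_witness[where i = prod.swap and j = prod.swap])
         (auto simp: ac_simps)
  qed
  show "1 * f = f"
  proof (rule series_eqI)
    fix m :: "'v \<Rightarrow>\<^sub>0 nat"
    have "coef (1 * f) m = (\<Sum>p\<in>{(a, b). a + b = m}. if p = (0, m) then coef f m else 0)"
      unfolding times_series.rep_eq one_series.rep_eq
      by (rule sum.cong) (auto split: if_splits)
    also have "\<dots> = coef f m"
      by (simp add: sum.delta[OF finite_splits])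
    finally show "coef (1 * f) m = coef f m" .
  qed
  show "(f + g) * h = f * h + g * h"
    by (rule series_eqI)
       (simp add: times_series.rep_eq plus_series.rep_eq case_prod_unfold distrib_right sum.distrib)
  show "(0 :: 'v series) \<noteq> 1"
    by transfer (auto simp: fun_eq_iff)
qed (transfer; simp add: fun_eq_iff)+

end

lift_definition scale :: "rat \<Rightarrow> 'v series \<Rightarrow> 'v series" (infixr \<open>*\<^sub>q\<close> 75)
  is "\<lambda>r f m. r * f m" .

global_interpretation series: vector_space "scale :: rat \<Rightarrow> 'v series \<Rightarrow> 'v series"
  by unfold_locales (transfer; simp add: fun_eq_iff algebra_simps)+

text \<open>
  Coordinates of a vector with respect to a basis given as an indexed family
  \<open>(b i)\<^sub>i\<close>, and the linear extension of an assignment \<open>b i \<mapsto> g i\<close>. They are meant for \<open>b\<close> injective on \<open>I\<close> with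
  independent image, and \<open>f\<close> in its span; outside the span the library's convention makes
  all coordinates zero.
\<close>

definition coord :: "'i set \<Rightarrow> ('i \<Rightarrow> 'v series) \<Rightarrow> 'v series \<Rightarrow> 'i \<Rightarrow> rat" where
  "coord I b f i = series.representation (b ` I) f (b i)"

definition lin_extend ::
  "'i set \<Rightarrow> ('i \<Rightarrow> 'v series) \<Rightarrow> ('i \<Rightarrow> 'w series) \<Rightarrow> 'v series \<Rightarrow> 'w series" where
  "lin_extend I b g f = (\<Sum>i | i \<in> I \<and> coord I b f i \<noteq> 0. coord I b f i *\<^sub>q g i)"


section \<open>Compositions\<close>

definition Comp :: "nat \<Rightarrow> nat list set" where
  "Comp n = {\<alpha>. (\<forall>a\<in>set \<alpha>. 0 < a) \<and> sum_list \<alpha> = n}"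

definition Comps :: "nat list set" where
  "Comps = (\<Union>n. Comp n)"

text \<open>The one-part composition \<open>(n)\<close>; parts are positive, so for \<open>n = 0\<close> it is the empty composition.\<close>

definition one_part :: "nat \<Rightarrow> nat list" where
  "one_part n = (if n = 0 then [] else [n])"

definition psums :: "nat list \<Rightarrow> nat set" where
  "psums \<alpha> = (\<lambda>i. sum_list (take i \<alpha>)) ` {1..<length \<alpha>}"

definition co :: "nat \<Rightarrow> nat set \<Rightarrow> nat list" where
  "co n = the_inv_into (Comp n) psums"

definition comp_le :: "nat list \<Rightarrow> nat list \<Rightarrow> bool" where
  "comp_le \<alpha> \<beta> \<longleftrightarrow> psums \<alpha> \<subseteq> psums \<beta>"


section \<open>Quasisymmetric functions\<close>

text \<open>
  \<open>M\<^sub>\<alpha>\<close>: the coefficient of a monomial counts the index sequences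
  \<open>i\<^sub>1 < \<dots> < i\<^sub>k\<close> with \<open>x\<^bsub>i\<^sub>1\<^esub>\<^bsup>a\<^sub>1\<^esup> \<cdots> x\<^bsub>i\<^sub>k\<^esub>\<^bsup>a\<^sub>k\<^esup>\<close> equal to it. The variables are
  numbered from \<open>0\<close>.
\<close>

definition QM :: "nat list \<Rightarrow> nat series" where
  "QM \<alpha> = Series (\<lambda>m. of_nat (card {js. length js = length \<alpha> \<and> sorted_wrt (<) js \<and>
     (\<Sum>j<length \<alpha>. Poly_Mapping.single (js ! j) (\<alpha> ! j)) = m}))"

definition QF :: "nat list \<Rightarrow> nat series" where
  "QF \<alpha> = (\<Sum>\<beta> | \<beta> \<in> Comp (sum_list \<alpha>) \<and> comp_le \<alpha> \<beta>. QM \<beta>)"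

definition QSym_deg :: "nat \<Rightarrow> nat series set" where
  "QSym_deg n = series.span (QM ` Comp n)"

definition QSym :: "nat series set" where
  "QSym = series.span (QM ` Comps)"

text \<open>
  The tensor product of two spaces of power series is realized inside the power series in
  two alphabets, \<open>f \<otimes> g\<close> being \<open>f(x) g(y)\<close> with \<open>x\<close> indexed by \<^const>\<open>Inl\<close> and \<open>y\<close> by
  \<^const>\<open>Inr\<close>; the induced map from the abstract tensor product is injective.
\<close>

definition tensor :: "'v series \<Rightarrow> 'w series \<Rightarrow> ('v + 'w) series" (infixr \<open>\<otimes>\<^sub>q\<close> 72) where
  "f \<otimes>\<^sub>q g = Series (\<lambda>m. coef f (Poly_Mapping.map_key Inl m) * coef g (Poly_Mapping.map_key Inr m))"

definition coproduct :: "nat series \<Rightarrow> (nat + nat) series" where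
  "coproduct = lin_extend Comps QM (\<lambda>\<alpha>. \<Sum>(\<beta>, \<gamma>) | \<beta> @ \<gamma> = \<alpha>. QM \<beta> \<otimes>\<^sub>q QM \<gamma>)"

definition counit :: "nat series \<Rightarrow> rat" where
  "counit f = coef f 0"

text \<open>\<open>\<Phi> \<otimes> \<Phi>\<close>, determined on the tensor square of \<^const>\<open>QSym\<close> by the basis \<open>M\<^sub>\<beta> \<otimes> M\<^sub>\<gamma>\<close>.\<close>

definition tensor_map :: "(nat series \<Rightarrow> nat series) \<Rightarrow> (nat + nat) series \<Rightarrow> (nat + nat) series" where
  "tensor_map \<Phi> = lin_extend (Comps \<times> Comps)
     (\<lambda>(\<beta>, \<gamma>). QM \<beta> \<otimes>\<^sub>q QM \<gamma>) (\<lambda>(\<beta>, \<gamma>). \<Phi> (QM \<beta>) \<otimes>\<^sub>q \<Phi> (QM \<gamma>))"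

text \<open>
  Graded Hopf algebra endomorphisms of \<^const>\<open>QSym\<close>. Only the values on \<^const>\<open>QSym\<close> matter.
  Compatibility with the antipode is automatic for bialgebra maps between Hopf algebras.
\<close>

definition End_QSym :: "(nat series \<Rightarrow> nat series) set" where
  "End_QSym = {\<Phi>.
     (\<forall>f\<in>QSym. \<forall>g\<in>QSym. \<Phi> (f + g) = \<Phi> f + \<Phi> g) \<and>
     (\<forall>r. \<forall>f\<in>QSym. \<Phi> (r *\<^sub>q f) = r *\<^sub>q \<Phi> f) \<and>
     (\<forall>n. \<Phi> ` QSym_deg n \<subseteq> QSym_deg n) \<and>
     \<Phi> 1 = 1 \<and>
     (\<forall>f\<in>QSym. \<forall>g\<in>QSym. \<Phi> (f * g) = \<Phi> f * \<Phi> g) \<and>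
     (\<forall>f\<in>QSym. counit (\<Phi> f) = counit f) \<and>
     (\<forall>f\<in>QSym. coproduct (\<Phi> f) = tensor_map \<Phi> (coproduct f))}"

definition cc :: "(nat series \<Rightarrow> nat series) \<Rightarrow> nat list \<Rightarrow> nat list \<Rightarrow> rat" where
  "cc \<Phi> \<alpha> \<beta> = coord (Comp (sum_list \<alpha>)) QF (\<Phi> (QF \<alpha>)) \<beta>"

definition lam :: "(nat series \<Rightarrow> nat series) \<Rightarrow> rat" where
  "lam \<Phi> = (THE l. \<Phi> (QM [1]) = l *\<^sub>q QM [1])"


section \<open>Descents and the two matrices\<close>

definition Sym :: "nat \<Rightarrow> (nat \<Rightarrow> nat) set" where
  "Sym n = {\<sigma>. \<sigma> permutes {1..n}}"

definition Des :: "nat \<Rightarrow> (nat \<Rightarrow> nat) \<Rightarrow> nat set" where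
  "Des n \<sigma> = {i \<in> {1..n - 1}. \<sigma> i > \<sigma> (i + 1)}"

definition descomp :: "nat \<Rightarrow> (nat \<Rightarrow> nat) \<Rightarrow> nat list" where
  "descomp n \<sigma> = co n (Des n \<sigma>)"

definition Prob :: "(nat series \<Rightarrow> nat series) \<Rightarrow> nat \<Rightarrow> (nat \<Rightarrow> nat) \<Rightarrow> rat" where
  "Prob \<Phi> n \<pi> = cc \<Phi> (descomp n \<pi>) (one_part n) /
     (\<Sum>\<sigma>\<in>Sym n. cc \<Phi> (descomp n \<sigma>) (one_part n))"

text \<open>\<open>K(\<pi>, \<sigma>\<pi>) = Prob(\<sigma>\<^sup>-\<^sup>1)\<close>, so the entry at \<open>(\<pi>, \<rho>)\<close> is obtained from \<open>\<sigma> = \<rho>\<pi>\<^sup>-\<^sup>1\<close>.\<close>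

definition K :: "(nat series \<Rightarrow> nat series) \<Rightarrow> nat \<Rightarrow> (nat \<Rightarrow> nat) \<Rightarrow> (nat \<Rightarrow> nat) \<Rightarrow> rat" where
  "K \<Phi> n \<pi> \<rho> = Prob \<Phi> n (inv (\<rho> \<circ> inv \<pi>))"

definition Kbar :: "(nat series \<Rightarrow> nat series) \<Rightarrow> nat \<Rightarrow> nat list \<Rightarrow> nat list \<Rightarrow> rat" where
  "Kbar \<Phi> n \<alpha> \<beta> = cc \<Phi> \<alpha> \<beta> / lam \<Phi> ^ n"

definition stochastic_on :: "'a set \<Rightarrow> ('a \<Rightarrow> 'a \<Rightarrow> rat) \<Rightarrow> bool" where
  "stochastic_on A P \<longleftrightarrow> (\<forall>x\<in>A. \<forall>y\<in>A. 0 \<le> P x y) \<and> (\<forall>x\<in>A. (\<Sum>y\<in>A. P x y) = 1)"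

end

theory Submission
  imports Defs "HOL-Library.Product_Lexorder"
begin

text \<open>
  Cut a word \<open>w\<close> into consecutive blocks of lengths \<open>\<gamma>\<close>. Multiplying out the fundamental
  functions of the blocks gives the sum of the fundamental functions of all shuffles of the blocks;
  for \<open>w = \<pi>\<close> the shuffles are the words \<open>\<pi>\<sigma>\<^sup>-\<^sup>1\<close> with \<open>Des \<sigma> \<subseteq> S\<^sub>\<gamma>\<close>. On the other hand, since
  \<open>\<Phi>\<close> respects coproducts, the coefficient of \<open>M\<^sub>\<gamma>\<close> in \<open>\<Phi>(F\<^bsub>D(\<pi>)\<^esub>)\<close> is the product over the blocks of
  the coefficients of \<open>x\<^sub>0\<^sup>g\<close> (\<open>g\<close> the block length) in the images of their fundamental functions. As \<open>\<Phi>\<close> is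
  multiplicative, both together say
  \<open>\<Phi>(F\<^bsub>D(\<pi>)\<^esub>) = \<Sum>\<^sub>\<sigma> c(\<pi>\<sigma>\<^sup>-\<^sup>1) F\<^bsub>D(\<sigma>)\<^esub>\<close>, where \<open>c(\<rho>)\<close> is the coefficient of \<open>x\<^sub>0\<^sup>n\<close> in \<open>\<Phi>(F\<^bsub>D(\<rho>)\<^esub>)\<close>, that is,
  \<open>c\<^bsub>D(\<rho>),(n)\<^esub>\<close>. For \<open>\<gamma> = (1\<^sup>n)\<close> the shuffles are all of \<open>Sym n\<close>, so the sum of all \<open>c(\<rho>)\<close> is \<open>\<lambda>\<^sup>n\<close>.
\<close>

section \<open>Linear algebra of series\<close>

lemma coef_0 [simp]: "coef 0 m = 0"
  by transfer simp

lemma coef_1: "coef 1 m = of_bool (m = 0)"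
  by transfer simp

lemma coef_add [simp]: "coef (f + g) m = coef f m + coef g m"
  by transfer simp

lemma coef_diff [simp]: "coef (f - g) m = coef f m - coef g m"
  by transfer simp

lemma coef_scale [simp]: "coef (r *\<^sub>q f) m = r * coef f m"
  by transfer simp

lemma coef_sum [simp]: "coef (\<Sum>i\<in>A. f i) m = (\<Sum>i\<in>A. coef (f i) m)"
  by (induction A rule: infinite_finite_induct) auto

lemma coef_Series [simp]: "coef (Series h) m = h m"
  by (simp add: Series_inverse)

lemma coef_tensor: "coef (f \<otimes>\<^sub>q g) m =
    coef f (Poly_Mapping.map_key Inl m) * coef g (Poly_Mapping.map_key Inr m)"
  by (simp add: tensor_def)

text \<open>A coincidence \<open>b i = b j\<close> with \<open>i \<noteq> j\<close> is itself a
  relation, with coefficients 1 and -1. So ruling out relations over index sets yields injectivity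
  along with independence of the image, the two facts under which \<open>coord\<close> and
  \<open>lin_extend\<close> behave as intended.\<close>

lemma independent_familyI:
  assumes indep: "\<And>A r. finite A \<Longrightarrow> A \<subseteq> I \<Longrightarrow> (\<Sum>i\<in>A. r i *\<^sub>q b i) = 0 \<Longrightarrow> \<forall>i\<in>A. r i = 0"
  shows "inj_on b I" and "series.independent (b ` I)"
proof -
  show inj: "inj_on b I"
  proof (rule inj_onI, rule ccontr)
    fix i j
    assume "i \<in> I" "j \<in> I" and eq: "b i = b j" and "i \<noteq> j"
    have "(\<Sum>l\<in>{i, j}. (if l = i then 1 else -1) *\<^sub>q b l) = 0"
      using \<open>i \<noteq> j\<close> eq by simp
    from indep[OF _ _ this] show False
      using \<open>i \<in> I\<close> \<open>j \<in> I\<close> by simp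
  qed
  show "series.independent (b ` I)"
    unfolding series.independent_explicit_module
  proof (intro allI impI)
    fix t u v
    assume "finite t" "t \<subseteq> b ` I" and sum0: "(\<Sum>v\<in>t. u v *\<^sub>q v) = 0" and "v \<in> t"
    then obtain A where A: "A \<subseteq> I" "inj_on b A" "t = b ` A"
      by (auto simp: subset_image_inj)
    then have "finite A"
      using \<open>finite t\<close> finite_image_iff by blast
    moreover have "(\<Sum>i\<in>A. u (b i) *\<^sub>q b i) = 0"
      using sum0 A by (simp add: sum.reindex)
    ultimately show "u v = 0"
      using indep[of A "\<lambda>i. u (b i)"] A \<open>v \<in> t\<close> by auto
  qed
qed

text \<open>The monomials \<open>m j\<close> serve as a dual family: extracting the coefficient of
  \<open>m i\<close> from a relation isolates \<open>r i\<close>.\<close>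

lemma independent_family_dual:
  assumes dual: "\<And>i j. i \<in> I \<Longrightarrow> j \<in> I \<Longrightarrow> coef (b i) (m j) = of_bool (i = j)"
  shows "inj_on b I" and "series.independent (b ` I)"
proof -
  have indep: "\<forall>i\<in>A. r i = 0" if A: "finite A" "A \<subseteq> I" "(\<Sum>i\<in>A. r i *\<^sub>q b i) = 0" for A r
  proof
    fix i assume i: "i \<in> A"
    have "0 = coef (\<Sum>j\<in>A. r j *\<^sub>q b j) (m i)"
      using A by simp
    also have "\<dots> = (\<Sum>j\<in>A. if j = i then r j else 0)"
      unfolding coef_sum using A i dual by (intro sum.cong) (auto simp: subset_iff)
    also have "\<dots> = r i"
      using A i by simp
    finally show "r i = 0" by simp
  qed
  show "inj_on b I" and "series.independent (b ` I)"
    by (rule independent_familyI; rule indep; assumption)+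
qed

lemma coord_sum:
  assumes "inj_on b I" "series.independent (b ` I)" "finite A" "A \<subseteq> I" "i \<in> I"
  shows "coord I b (\<Sum>j\<in>A. r j *\<^sub>q b j) i = (if i \<in> A then r i else 0)"
proof -
  have span: "b j \<in> series.span (b ` I)" if "j \<in> A" for j
    using that assms by (auto intro: series.span_base)
  have "coord I b (\<Sum>j\<in>A. r j *\<^sub>q b j) i
      = (\<Sum>j\<in>A. series.representation (b ` I) (r j *\<^sub>q b j) (b i))"
    unfolding coord_def using assms span
    by (subst series.representation_sum) (auto intro: series.span_scale)
  also have "\<dots> = (\<Sum>j\<in>A. if j = i then r i else 0)"
  proof (rule sum.cong)
    fix j assume j: "j \<in> A"
    then have "series.representation (b ` I) (b j) (b i) = of_bool (j = i)"
      using assms by (subst series.representation_basis) (auto simp: inj_on_eq_iff subset_iff)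
    then show "series.representation (b ` I) (r j *\<^sub>q b j) (b i) = (if j = i then r i else 0)"
      using assms span j by (subst series.representation_scale) auto
  qed simp
  also have "\<dots> = (if i \<in> A then r i else 0)"
    using assms by simp
  finally show ?thesis .
qed

lemma lin_extend_sum:
  assumes "inj_on b I" "series.independent (b ` I)" "finite A" "A \<subseteq> I"
  shows "lin_extend I b g (\<Sum>i\<in>A. r i *\<^sub>q b i) = (\<Sum>i\<in>A. r i *\<^sub>q g i)"
  unfolding lin_extend_def
\<comment> \<open>\<open>lin_extend\<close> sums only over indices with nonzero coordinate; the
  other elements of \<open>A\<close> have \<open>r i = 0\<close> and add nothing.\<close>
proof (rule sum.mono_neutral_cong_left)
  show "\<forall>i\<in>A - {i \<in> I. coord I b (\<Sum>j\<in>A. r j *\<^sub>q b j) i \<noteq> 0}. r i *\<^sub>q g i = 0"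
    using assms by (auto simp: coord_sum subset_iff)
qed (use assms in \<open>auto simp: coord_sum split: if_splits\<close>)

lemma span_image_expansion:
  assumes "f \<in> series.span (b ` I)"
  obtains A r where "finite A" "A \<subseteq> I" "f = (\<Sum>i\<in>A. r i *\<^sub>q b i)"
proof -
  from assms obtain t u where t: "finite t" "t \<subseteq> b ` I" "f = (\<Sum>v\<in>t. u v *\<^sub>q v)"
    by (auto simp: series.span_explicit)
  then obtain A where A: "A \<subseteq> I" "inj_on b A" "t = b ` A"
    by (auto simp: subset_image_inj)
  show ?thesis
  proof (rule that)
    show "finite A"
      using t A finite_image_iff by blast
    show "f = (\<Sum>i\<in>A. u (b i) *\<^sub>q b i)"
      using t A by (simp add: sum.reindex)
  qed (rule A)
qed

section \<open>Monomials and compositions\<close>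

definition expo :: "'v list \<Rightarrow> nat list \<Rightarrow> 'v \<Rightarrow>\<^sub>0 nat" where
  "expo ks \<gamma> = (\<Sum>j<length \<gamma>. Poly_Mapping.single (ks ! j) (\<gamma> ! j))"

lemma expo_Nil [simp]: "expo ks [] = 0"
  by (simp add: expo_def)

lemma expo_Cons [simp]: "expo (k # ks) (g # \<gamma>) = Poly_Mapping.single k g + expo ks \<gamma>"
  by (simp add: expo_def sum.lessThan_Suc_shift del: sum.lessThan_Suc)

lemma Comps_iff: "\<gamma> \<in> Comps \<longleftrightarrow> (\<forall>a\<in>set \<gamma>. 0 < a)"
  by (auto simp: Comps_def Comp_def)

lemma Comp_iff: "\<gamma> \<in> Comp n \<longleftrightarrow> \<gamma> \<in> Comps \<and> sum_list \<gamma> = n"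
  by (auto simp: Comps_iff Comp_def)

lemma Comps_simps [simp]:
  "[] \<in> Comps"
  "g # \<gamma> \<in> Comps \<longleftrightarrow> 0 < g \<and> \<gamma> \<in> Comps"
  "\<beta> @ \<gamma> \<in> Comps \<longleftrightarrow> \<beta> \<in> Comps \<and> \<gamma> \<in> Comps"
  by (auto simp: Comps_iff)

lemma one_part_in_Comp [simp]: "one_part n \<in> Comp n"
  by (auto simp: one_part_def Comp_iff)

lemma lookup_expo_notin: "length ks = length \<gamma> \<Longrightarrow> x \<notin> set ks \<Longrightarrow> Poly_Mapping.lookup (expo ks \<gamma>) x = 0"
  by (induction ks \<gamma> rule: list_induct2) (auto simp: lookup_add lookup_single_not_eq)

lemma map_lookup_expo:
  "length ks = length \<gamma> \<Longrightarrow> distinct ks \<Longrightarrow> map (Poly_Mapping.lookup (expo ks \<gamma>)) ks = \<gamma>"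
proof (induction ks \<gamma> rule: list_induct2)
  case (Cons k ks g \<gamma>)
  have "map (Poly_Mapping.lookup (expo (k # ks) (g # \<gamma>))) ks = map (Poly_Mapping.lookup (expo ks \<gamma>)) ks"
    using Cons.prems by (auto simp: lookup_add lookup_single when_def)
  moreover have "Poly_Mapping.lookup (expo (k # ks) (g # \<gamma>)) k = g"
    using Cons by (simp add: lookup_add lookup_expo_notin)
  ultimately show ?case
    using Cons by (simp del: expo_Cons map_eq_conv)
qed simp

lemma keys_expo:
  assumes "length ks = length \<gamma>" "distinct ks" "\<gamma> \<in> Comps"
  shows "Poly_Mapping.keys (expo ks \<gamma>) = set ks"
proof (rule set_eqI)
  fix x
  show "x \<in> Poly_Mapping.keys (expo ks \<gamma>) \<longleftrightarrow> x \<in> set ks"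
  proof (cases "x \<in> set ks")
    case True
    then have "Poly_Mapping.lookup (expo ks \<gamma>) x \<in> set \<gamma>"
      using map_lookup_expo[OF assms(1,2)] by (metis image_eqI list.set_map)
    then show ?thesis
      using assms(3) True by (auto simp: Comps_iff in_keys_iff)
  qed (use assms in \<open>auto simp: in_keys_iff lookup_expo_notin\<close>)
qed

lemma expo_map_lookup:
  "distinct ks \<Longrightarrow> Poly_Mapping.keys m = set ks \<Longrightarrow> expo ks (map (Poly_Mapping.lookup m) ks) = m"
proof (rule poly_mapping_eqI)
  fix x
  assume ks: "distinct ks" "Poly_Mapping.keys m = set ks"
  show "Poly_Mapping.lookup (expo ks (map (Poly_Mapping.lookup m) ks)) x = Poly_Mapping.lookup m x"
  proof (cases "x \<in> set ks")
    case True
    then show ?thesis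
      using map_lookup_expo[OF _ ks(1), of "map (Poly_Mapping.lookup m) ks"] by simp
  next
    case False
    then show ?thesis
      using ks by (simp add: lookup_expo_notin) (metis in_keys_iff)
  qed
qed

definition vars :: "('v::linorder \<Rightarrow>\<^sub>0 nat) \<Rightarrow> 'v list" where
  "vars m = sorted_list_of_set (Poly_Mapping.keys m)"

definition exps :: "('v::linorder \<Rightarrow>\<^sub>0 nat) \<Rightarrow> nat list" where
  "exps m = map (Poly_Mapping.lookup m) (vars m)"

lemma expo_vars_exps: "expo (vars m) (exps m) = m"
  unfolding exps_def by (rule expo_map_lookup) (auto simp: vars_def)

lemma exps_in_Comps [simp]: "exps m \<in> Comps"
  by (auto simp: Comps_iff exps_def vars_def in_keys_iff)

text \<open>Positive parts make the support of \<open>expo ks \<gamma>\<close> equal to the set of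
  \<open>ks\<close>, and a strictly increasing list is determined by its set. Hence a monomial has
  only one such presentation.\<close>

lemma expo_eq_imp:
  assumes "length ks = length \<gamma>" "sorted_wrt (<) ks" "\<gamma> \<in> Comps" "expo ks \<gamma> = m"
  shows "ks = vars m" and "\<gamma> = exps m"
proof -
  have "distinct ks"
    using assms(2) strict_sorted_iff by blast
  then have "Poly_Mapping.keys m = set ks"
    using keys_expo assms by metis
  then show ks: "ks = vars m"
    using assms(2) unfolding vars_def by (metis sorted_list_of_set.idem_if_sorted_distinct strict_sorted_iff)
  show "\<gamma> = exps m"
    using map_lookup_expo[OF assms(1) \<open>distinct ks\<close>] assms(4) ks by (simp add: exps_def)
qed

text \<open>The cardinality in \<open>QM\<close> counts presentations of \<open>m\<close> with
  exponents \<open>\<gamma>\<close>; the only candidate is \<open>vars m\<close> with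
  \<open>exps m\<close>. The monomials are thus distributed among the \<open>QM\<close> by their
  exponent sequence.\<close>

lemma coef_QM:
  assumes "\<gamma> \<in> Comps"
  shows "coef (QM \<gamma>) m = of_bool (\<gamma> = exps m)"
proof -
  have "ks = vars m \<and> \<gamma> = exps m"
    if "length ks = length \<gamma>" "sorted_wrt (<) ks" "expo ks \<gamma> = m" for ks
    using expo_eq_imp[OF that(1,2) assms that(3)] by blast
  moreover have "length (vars m) = length (exps m) \<and> sorted_wrt (<) (vars m) \<and> expo (vars m) (exps m) = m"
    using expo_vars_exps[of m] by (simp add: exps_def vars_def)
  ultimately have "{ks. length ks = length \<gamma> \<and> sorted_wrt (<) ks \<and> expo ks \<gamma> = m} =
      (if \<gamma> = exps m then {vars m} else {})"
    by (intro set_eqI) (metis (mono_tags, lifting) empty_iff mem_Collect_eq singleton_iff)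
  then show ?thesis
    by (simp add: QM_def expo_def[symmetric])
qed

text \<open>A representative of the monomials of \<open>QM \<gamma>\<close>, packed into the first
  variables. These representatives are dual to the basis \<open>QM\<close>, so coordinates in that
  basis are coefficients at \<open>std_mon\<close>.\<close>

definition std_mon :: "nat list \<Rightarrow> nat \<Rightarrow>\<^sub>0 nat" where
  "std_mon \<gamma> = expo [0..<length \<gamma>] \<gamma>"

lemma exps_std_mon [simp]: "\<gamma> \<in> Comps \<Longrightarrow> exps (std_mon \<gamma>) = \<gamma>"
  using expo_eq_imp(2)[of "[0..<length \<gamma>]" \<gamma>] by (simp add: std_mon_def)

lemma coef_QM_std_mon: "\<beta> \<in> Comps \<Longrightarrow> \<gamma> \<in> Comps \<Longrightarrow> coef (QM \<beta>) (std_mon \<gamma>) = of_bool (\<beta> = \<gamma>)"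
  by (simp add: coef_QM)

lemma std_mon_one_part: "std_mon (one_part n) = Poly_Mapping.single 0 n"
  by (simp add: std_mon_def one_part_def)

lemma QM_Nil: "QM [] = 1"
  by (rule series_eqI) (auto simp: coef_QM coef_1 exps_def vars_def)

lemma inj_QM: "inj_on QM Comps" and independent_QM: "series.independent (QM ` Comps)"
  by (rule independent_family_dual[where m = std_mon]; simp add: coef_QM_std_mon)+

section \<open>Homogeneous components and their coefficients\<close>

lemma QSym_deg_subset: "QSym_deg n \<subseteq> QSym"
  unfolding QSym_deg_def QSym_def by (intro series.span_mono image_mono) (auto simp: Comp_iff)

lemma QM_in_QSym_deg: "\<gamma> \<in> Comp n \<Longrightarrow> QM \<gamma> \<in> QSym_deg n"
  unfolding QSym_deg_def by (auto intro: series.span_base)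

lemma coef_QSym_deg_neq:
  assumes "f \<in> QSym_deg n" "\<gamma> \<in> Comps" "sum_list \<gamma> \<noteq> n"
  shows "coef f (std_mon \<gamma>) = 0"
proof -
  obtain A r where A: "finite A" "A \<subseteq> Comp n" "f = (\<Sum>\<beta>\<in>A. r \<beta> *\<^sub>q QM \<beta>)"
    using assms(1) unfolding QSym_deg_def by (rule span_image_expansion)
  have "coef (QM \<beta>) (std_mon \<gamma>) = 0" if "\<beta> \<in> A" for \<beta>
    using that A assms by (subst coef_QM_std_mon) (auto simp: Comp_iff)
  then show ?thesis
    using A by simp
qed

lemma QSym_deg_eqI:
  assumes "f \<in> QSym_deg n" "g \<in> QSym_deg n"
    and "\<And>\<gamma>. \<gamma> \<in> Comp n \<Longrightarrow> coef f (std_mon \<gamma>) = coef g (std_mon \<gamma>)"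
  shows "f = g"
proof -
  have "f - g \<in> QSym_deg n"
    using assms unfolding QSym_deg_def by (intro series.span_diff)
  then obtain A r where A: "finite A" "A \<subseteq> Comp n" "f - g = (\<Sum>\<beta>\<in>A. r \<beta> *\<^sub>q QM \<beta>)"
    unfolding QSym_deg_def by (rule span_image_expansion)
  have "r \<gamma> = 0" if "\<gamma> \<in> A" for \<gamma>
  proof -
    have "coef (f - g) (std_mon \<gamma>) = (\<Sum>\<beta>\<in>A. if \<beta> = \<gamma> then r \<beta> else 0)"
      unfolding A(3) coef_sum using A that
      by (intro sum.cong) (auto simp: coef_QM_std_mon Comp_iff subset_iff)
    also have "\<dots> = r \<gamma>"
      using A that by simp
    finally show ?thesis
      using assms(3)[of \<gamma>] that A(2) by (auto simp only: coef_diff subset_iff)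
  qed
  then show ?thesis
    using A by simp
qed

text \<open>Reading off the coefficient of a power of \<open>x_0\<close> is the canonical character
  of quasisymmetric functions. A power of \<open>x_0\<close> factors only into powers of
  \<open>x_0\<close>, and homogeneity leaves the single factorization with exponents
  \<open>k\<close> and \<open>l\<close>.\<close>

lemma coef_single_mult:
  assumes "f \<in> QSym_deg k" "g \<in> QSym_deg l"
  shows "coef (f * g) (Poly_Mapping.single 0 (k + l)) =
    coef f (Poly_Mapping.single 0 k) * coef g (Poly_Mapping.single 0 l)"
proof -
  let ?s = "Poly_Mapping.single (0::nat)"
  have "coef (f * g) (?s (k + l)) = (\<Sum>p\<in>{(a, b). a + b = ?s (k + l)}.
      if p = (?s k, ?s l) then coef f (?s k) * coef g (?s l) else 0)"
    unfolding times_series.rep_eq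
  proof (rule sum.cong)
    fix p assume "p \<in> {(a, b). a + b = ?s (k + l)}"
    then obtain a b where p: "p = (a, b)" "a + b = ?s (k + l)"
      by auto
    have single: "c = ?s (Poly_Mapping.lookup c 0)" if "c + d = ?s (k + l)" for c d
    proof (rule poly_mapping_eqI)
      fix x
      have "Poly_Mapping.lookup c x + Poly_Mapping.lookup d x = Poly_Mapping.lookup (?s (k + l)) x"
        by (simp flip: that add: lookup_add)
      then show "Poly_Mapping.lookup c x = Poly_Mapping.lookup (?s (Poly_Mapping.lookup c 0)) x"
        by (cases "x = 0") (auto simp: lookup_single_not_eq)
    qed
    obtain i j where ij: "a = ?s i" "b = ?s j"
      using single p(2) by (metis add.commute)
    then have "i + j = k + l"
      using p(2) by (metis lookup_add lookup_single_eq)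
    moreover have "coef f (?s i) = 0" if "i \<noteq> k"
      using coef_QSym_deg_neq[OF assms(1), of "one_part i"] that one_part_in_Comp[of i]
      by (simp add: Comp_iff std_mon_one_part)
    moreover have "?s i = ?s k \<longleftrightarrow> i = k" and "?s j = ?s l \<longleftrightarrow> j = l"
      by (metis lookup_single_eq)+
    ultimately show "(case p of (a, b) \<Rightarrow> coef f a * coef g b) =
        (if p = (?s k, ?s l) then coef f (?s k) * coef g (?s l) else 0)"
      unfolding p(1) ij by (cases "i = k") auto
  qed simp
  also have "\<dots> = coef f (?s k) * coef g (?s l)"
    by (simp add: finite_splits flip: single_add)
  finally show ?thesis .
qed

section \<open>Compositions and their sets of partial sums\<close>

lemma psums_Cons: "psums (a # \<alpha>) = (if \<alpha> = [] then {} else insert a ((+) a ` psums \<alpha>))"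
proof (cases "\<alpha> = []")
  case False
  then have "{1..<length (a # \<alpha>)} = insert 1 (Suc ` {1..<length \<alpha>})"
    by (cases \<alpha>) (auto simp: image_Suc_atLeastLessThan)
  then have "psums (a # \<alpha>) = (\<lambda>i. sum_list (take i (a # \<alpha>))) ` insert 1 (Suc ` {1..<length \<alpha>})"
    by (simp only: psums_def)
  then show ?thesis
    using False by (simp add: psums_def image_image del: image_Suc_atLeastLessThan)
qed (simp add: psums_def)

lemma psums_Nil [simp]: "psums [] = {}"
  by (simp add: psums_def)

lemma psums_subset: "\<alpha> \<in> Comp n \<Longrightarrow> psums \<alpha> \<subseteq> {1..<n}"
proof (induction \<alpha> arbitrary: n)
  case (Cons a \<alpha>)
  have "psums \<alpha> \<subseteq> {1..<n - a}"
    by (rule Cons.IH) (use Cons.prems in \<open>auto simp: Comp_iff\<close>)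
  then have "1 \<le> x \<and> a + x < n" if "x \<in> psums \<alpha>" for x
    using that by force
  moreover have "0 < a"
    using Cons.prems by (simp add: Comp_iff)
  moreover have "a < n" if "\<alpha> \<noteq> []"
    using Cons.prems that by (cases \<alpha>) (auto simp: Comp_iff)
  ultimately show ?case
    by (auto simp: psums_Cons)
qed simp

text \<open>With at least two parts, the first part is the least element of the set; comparing least
  elements and subtracting reduces the claim to the tails.\<close>

lemma psums_inject: "\<alpha> \<in> Comp n \<Longrightarrow> \<beta> \<in> Comp n \<Longrightarrow> psums \<alpha> = psums \<beta> \<Longrightarrow> \<alpha> = \<beta>"
proof (induction \<alpha> arbitrary: \<beta> n)
  case Nil
  then show ?case
    by (cases \<beta>) (auto simp: Comp_iff)
next
  case (Cons a \<alpha>)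
  then obtain b \<beta>' where \<beta>: "\<beta> = b # \<beta>'"
    by (cases \<beta>) (auto simp: Comp_iff)
  show ?case
  proof (cases "\<alpha> = [] \<or> \<beta>' = []")
    case True
    then show ?thesis
      using Cons.prems \<beta> by (auto simp: psums_Cons Comp_iff split: if_splits)
  next
    case False
    have \<alpha>: "\<alpha> \<in> Comp (n - a)" and \<beta>': "\<beta>' \<in> Comp (n - b)"
      using Cons.prems \<beta> by (auto simp: Comp_iff)
    have eq: "insert a ((+) a ` psums \<alpha>) = insert b ((+) b ` psums \<beta>')"
      using Cons.prems(3) False by (simp add: \<beta> psums_Cons)
    \<comment> \<open>Without 0, the shifted sets avoid \<open>a\<close>, so the inserted element
      can be cancelled below.\<close>
    have pos: "0 \<notin> psums \<alpha>" "0 \<notin> psums \<beta>'"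
      using psums_subset \<alpha> \<beta>' by fastforce+
    \<comment> \<open>Each of \<open>a\<close> and \<open>b\<close> lies in a set whose elements are
      at least the other one.\<close>
    have "a \<in> insert b ((+) b ` psums \<beta>')" "b \<in> insert a ((+) a ` psums \<alpha>)"
      using eq by blast+
    then have "a = b"
      by auto
    then have "(+) a ` psums \<alpha> = (+) a ` psums \<beta>'"
      using eq pos by (metis add_cancel_right_right imageE insert_ident)
    then have "psums \<alpha> = psums \<beta>'"
      by (simp add: inj_image_eq_iff)
    with Cons.IH \<alpha> \<beta>' \<open>a = b\<close> \<beta> show ?thesis
      by blast
  qed
qed

text \<open>The least element of \<open>S\<close> becomes the first part; the remaining elements,
  shifted down by it, come from a composition of \<open>n - a\<close> by induction.\<close>

lemma psums_surj: "S \<subseteq> {1..<n} \<Longrightarrow> \<exists>\<alpha>\<in>Comp n. psums \<alpha> = S"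
proof (induction n arbitrary: S rule: less_induct)
  case (less n)
  show ?case
  proof (cases "S = {}")
    case True
    then show ?thesis
      by (intro bexI[OF _ one_part_in_Comp]) (auto simp: one_part_def psums_Cons)
  next
    case False
    define a where "a = Min S"
    have "finite S"
      using less.prems finite_subset by blast
    then have a: "a \<in> S" "\<And>x. x \<in> S \<Longrightarrow> a \<le> x"
      using False by (auto simp: a_def)
    then have "0 < a" "a < n"
      using less.prems by auto
    have "(\<lambda>x. x - a) ` (S - {a}) \<subseteq> {1..<n - a}"
    proof (rule image_subsetI)
      fix x assume "x \<in> S - {a}"
      then show "x - a \<in> {1..<n - a}"
        using a(2)[of x] less.prems by (auto simp: subset_iff)
    qed
    then obtain \<alpha> where \<alpha>: "\<alpha> \<in> Comp (n - a)" "psums \<alpha> = (\<lambda>x. x - a) ` (S - {a})"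
      using less.IH[of "n - a"] \<open>0 < a\<close> \<open>a < n\<close> by (metis diff_less less_trans)
    have "\<alpha> \<noteq> []"
      using \<alpha>(1) \<open>a < n\<close> by (auto simp: Comp_iff)
    moreover have "(+) a ` psums \<alpha> = S - {a}"
      unfolding \<alpha>(2) image_image using a(2) by (force intro: image_eqI)
    ultimately have "psums (a # \<alpha>) = S"
      using a(1) by (auto simp: psums_Cons)
    moreover have "a # \<alpha> \<in> Comp n"
      using \<alpha>(1) \<open>0 < a\<close> \<open>a < n\<close> by (auto simp: Comp_iff)
    ultimately show ?thesis
      by blast
  qed
qed

lemma inj_on_psums: "inj_on psums (Comp n)"
  using psums_inject by (intro inj_onI)

lemma psums_image_Comp: "psums ` Comp n = Pow {1..<n}"
  using psums_subset psums_surj by (auto simp: image_iff) blast+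

lemma finite_Comp [simp]: "finite (Comp n)"
  by (rule finite_imageD[OF _ inj_on_psums]) (simp add: psums_image_Comp)

lemma co_in_Comp: "S \<subseteq> {1..<n} \<Longrightarrow> co n S \<in> Comp n"
  unfolding co_def by (rule the_inv_into_into[OF inj_on_psums]) (auto simp: psums_image_Comp)

lemma psums_co: "S \<subseteq> {1..<n} \<Longrightarrow> psums (co n S) = S"
  unfolding co_def by (rule f_the_inv_into_f[OF inj_on_psums]) (auto simp: psums_image_Comp)

lemma co_psums: "\<alpha> \<in> Comp n \<Longrightarrow> co n (psums \<alpha>) = \<alpha>"
  unfolding co_def by (rule the_inv_into_f_f[OF inj_on_psums])

section \<open>The generating function of a word\<close>

text \<open>The cuts of a word into strictly increasing consecutive blocks, so equal neighbours act
  like a descent. Allowing any linear order of letters makes this usable for words of pairs (index,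
  letter) as well.\<close>

fun fits :: "nat list \<Rightarrow> 'a::linorder list \<Rightarrow> bool" where
  "fits [] w \<longleftrightarrow> w = []"
| "fits (g # \<gamma>) w \<longleftrightarrow> 0 < g \<and> g \<le> length w \<and> sorted_wrt (<) (take g w) \<and> fits \<gamma> (drop g w)"

lemma fits_imp_Comp: "fits \<gamma> w \<Longrightarrow> \<gamma> \<in> Comp (length w)"
  by (induction \<gamma> w rule: fits.induct) (auto simp: Comp_iff)

lemma fits_append:
  "fits (\<beta> @ \<gamma>) w \<longleftrightarrow> sum_list \<beta> \<le> length w \<and>
    fits \<beta> (take (sum_list \<beta>) w) \<and> fits \<gamma> (drop (sum_list \<beta>) w)"
proof (induction \<beta> arbitrary: w)
  case (Cons b \<beta>)
  show ?case
    by (auto simp: Cons drop_take add.commute min_def)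
qed simp

text \<open>A block increases iff its neighbouring letters do, and the boundary before the letter at
  position \<open>i\<close> (counted from 0) lies inside a block iff \<open>i\<close> is not a
  partial sum.\<close>

lemma fits_iff_psums:
  "\<gamma> \<in> Comp (length w) \<Longrightarrow>
    fits \<gamma> w \<longleftrightarrow> (\<forall>i\<in>{1..<length w}. i \<notin> psums \<gamma> \<longrightarrow> w ! (i - 1) < w ! i)"
proof (induction \<gamma> arbitrary: w)
  case (Cons g \<gamma>)
  let ?n = "length w"
  have g: "0 < g" "g \<le> ?n" and \<gamma>: "\<gamma> \<in> Comp (length (drop g w))"
    using Cons.prems by (auto simp: Comp_iff)
  have 1: "sorted_wrt (<) (take g w) \<longleftrightarrow> (\<forall>i\<in>{1..<g}. w ! (i - 1) < w ! i)"
  proof -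
    have "sorted_wrt (<) (take g w) \<longleftrightarrow> (\<forall>i. Suc i < g \<longrightarrow> w ! i < w ! Suc i)"
      using g by (simp add: sorted_wrt_iff_nth_Suc_transp min_def)
    also have "\<dots> \<longleftrightarrow> (\<forall>i\<in>{1..<g}. w ! (i - 1) < w ! i)"
      by (auto simp: Ball_def) (metis Suc_pred less_eq_Suc_le)
    finally show ?thesis .
  qed
  have 2: "fits \<gamma> (drop g w) \<longleftrightarrow>
      (\<forall>i\<in>{1..<?n - g}. i \<notin> psums \<gamma> \<longrightarrow> w ! (g + i - 1) < w ! (g + i))"
    unfolding Cons.IH[OF \<gamma>] using g by (intro ball_cong) auto
  show ?case
  proof (cases "\<gamma> = []")
    case True
    then show ?thesis
      using g 1 Cons.prems by (simp add: psums_Cons Comp_iff)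
  next
    case False
    have mem: "i \<in> psums (g # \<gamma>) \<longleftrightarrow> i = g \<or> (g \<le> i \<and> i - g \<in> psums \<gamma>)" for i
      using False by (auto simp: psums_Cons image_iff intro!: bexI[of _ "i - g"])
    have "fits (g # \<gamma>) w \<longleftrightarrow> (\<forall>i\<in>{1..<g}. w ! (i - 1) < w ! i) \<and>
      (\<forall>i\<in>{1..<?n - g}. i \<notin> psums \<gamma> \<longrightarrow> w ! (g + i - 1) < w ! (g + i))"
      using g 1 2 by simp
    also have "(\<forall>i\<in>{1..<?n - g}. i \<notin> psums \<gamma> \<longrightarrow> w ! (g + i - 1) < w ! (g + i)) \<longleftrightarrow>
      (\<forall>i\<in>{g<..<?n}. i - g \<notin> psums \<gamma> \<longrightarrow> w ! (i - 1) < w ! i)" (is "?l \<longleftrightarrow> ?r")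
    proof safe
      fix i assume ?l and i: "i \<in> {g<..<?n}" "i - g \<notin> psums \<gamma>"
      have "i - g \<in> {1..<?n - g}" "g + (i - g) = i"
        using i(1) by auto
      then show "w ! (i - 1) < w ! i"
        using bspec[OF \<open>?l\<close>, of "i - g"] i(2) by simp
    next
      fix i assume ?r "i \<in> {1..<?n - g}" "i \<notin> psums \<gamma>"
      then show "w ! (g + i - 1) < w ! (g + i)"
        using bspec[OF \<open>?r\<close>, of "g + i"] by auto
    qed
    also have "(\<forall>i\<in>{1..<g}. w ! (i - 1) < w ! i) \<and> \<dots> \<longleftrightarrow>
      (\<forall>i\<in>{1..<?n}. i \<notin> psums (g # \<gamma>) \<longrightarrow> w ! (i - 1) < w ! i)"
      unfolding mem using g
      by (auto simp: not_less_iff_gr_or_eq intro: nat_neq_iff[THEN iffD1, THEN disjE])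
    finally show ?thesis .
  qed
qed (auto simp: Comp_iff)

text \<open>The fundamental quasisymmetric function of the descent set of a word;
  \<open>GF_word\<close> identifies it with \<open>QF\<close> for permutations. Indexing by words
  makes blocks and rearrangements of a permutation available directly.\<close>

definition GF :: "'a::linorder list \<Rightarrow> nat series" where
  "GF w = (\<Sum>\<gamma> | fits \<gamma> w. QM \<gamma>)"

lemma finite_fits [simp]: "finite {\<gamma>. fits \<gamma> w}"
  by (rule finite_subset[OF _ finite_Comp[of "length w"]]) (auto intro: fits_imp_Comp)

lemma GF_in_QSym_deg: "GF w \<in> QSym_deg (length w)"
  unfolding GF_def using QM_in_QSym_deg fits_imp_Comp
  by (auto simp: QSym_deg_def intro!: series.span_sum)

lemma GF_Nil: "GF ([] :: 'a::linorder list) = 1"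
proof -
  have "fits \<gamma> ([] :: 'a list) \<longleftrightarrow> \<gamma> = []" for \<gamma>
    by (cases \<gamma>) auto
  then show ?thesis
    by (simp add: GF_def QM_Nil)
qed

lemma coef_GF_exps: "coef (GF w) m = of_bool (fits (exps m) w)"
proof -
  have "coef (GF w) m = (\<Sum>\<gamma> | fits \<gamma> w. if \<gamma> = exps m then 1 else 0)"
    unfolding GF_def coef_sum by (intro sum.cong) (auto simp: coef_QM Comp_iff dest!: fits_imp_Comp)
  then show ?thesis
    by simp
qed

section \<open>Index sequences and lexicographically increasing words of pairs\<close>

definition wmon :: "'v list \<Rightarrow> 'v \<Rightarrow>\<^sub>0 nat" where
  "wmon js = expo js (replicate (length js) 1)"

lemma wmon_simps [simp]:
  "wmon [] = 0"
  "wmon (j # js) = Poly_Mapping.single j 1 + wmon js"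
  by (simp_all add: wmon_def)

lemma wmon_append [simp]: "wmon (js @ ks) = wmon js + wmon ks"
  by (induction js) (auto simp: add.assoc)

lemma wmon_replicate [simp]: "wmon (replicate g k) = Poly_Mapping.single k g"
  by (induction g) (auto simp flip: single_add)

lemma lookup_wmon: "Poly_Mapping.lookup (wmon js) x = count (mset js) x"
  by (induction js) (auto simp: lookup_add lookup_single when_def)

lemma wmon_eq_iff: "wmon js = wmon ks \<longleftrightarrow> mset js = mset ks"
  by (auto simp: poly_mapping_eq_iff fun_eq_iff lookup_wmon multiset_eq_iff)

lemma sorted_wrt_zip_imp_sorted:
  "length js = length w \<Longrightarrow> sorted_wrt (<) (zip js w) \<Longrightarrow> sorted js"
proof (induction js w rule: list_induct2)
  case (Cons j js b w)
  have "j \<le> x" if "x \<in> set js" for x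
  proof -
    obtain c where "(x, c) \<in> set (zip js w)"
      using Cons.hyps(1) \<open>x \<in> set js\<close> by (rule in_set_impl_in_set_zip1)
    then show ?thesis
      using Cons.prems by (auto simp: less_prod_def)
  qed
  with Cons show ?case
    by simp
qed simp

text \<open>Runs of equal indices become the blocks, since the letters must increase strictly while
  the index is constant. The clause on heads strengthens the induction: a new first letter opens a
  block of its own or joins the first block, according to whether its index is smaller than or equal
  to the next one.\<close>

lemma sorted_zip_imp_fits:
  fixes js :: "'v::linorder list"
  assumes "length js = length w" "sorted_wrt (<) (zip js w)"
  shows "\<exists>ks \<gamma>. length ks = length \<gamma> \<and> sorted_wrt (<) ks \<and> fits \<gamma> w \<and> expo ks \<gamma> = wmon js \<and>
    (js \<noteq> [] \<longrightarrow> ks \<noteq> [] \<and> hd ks = hd js)"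
  using assms
proof (induction js w rule: list_induct2)
  case Nil
  show ?case
    by (rule exI[of _ "[]"], rule exI[of _ "[]"]) simp
next
  case (Cons a js b w)
  then obtain ks \<gamma> where IH: "length ks = length \<gamma>" "sorted_wrt (<) ks" "fits \<gamma> w"
      "expo ks \<gamma> = wmon js" "js \<noteq> [] \<longrightarrow> ks \<noteq> [] \<and> hd ks = hd js"
    by auto
  show ?case
  proof (cases "js = []")
    case True
    then show ?thesis
      using Cons.hyps by (intro exI[of _ "[a]"] exI[of _ "[1]"]) simp
  next
    case False
    then obtain j js' where js: "js = j # js'" by (cases js) auto
    then obtain c w' where w: "w = c # w'"
      using Cons.hyps by (cases w) auto
    obtain ks' where ks: "ks = j # ks'"
      using IH(5) js by (cases ks) auto
    then obtain g \<gamma>' where \<gamma>: "\<gamma> = g # \<gamma>'"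
      using IH(1) by (cases \<gamma>) auto
    have "(a, b) < (j, c)"
      using Cons.prems by (simp add: js w)
    then consider "a < j" | "a = j" "b < c"
      by (auto simp: less_prod_def order_le_less)
    then show ?thesis
    proof cases
      case 1
      then show ?thesis
        using IH ks \<gamma> w by (intro exI[of _ "a # ks"] exI[of _ "1 # \<gamma>"]) auto
    next
      case 2
      have g: "0 < g" "g \<le> length w" "sorted_wrt (<) (take g w)" "fits \<gamma>' (drop g w)"
        using IH(3) \<gamma> by auto
      then have "sorted_wrt (<) (b # take g w)"
        using 2 by (cases g) (auto simp: w)
      then have "fits (Suc g # \<gamma>') (b # w)"
        using g by auto
      moreover have "expo ks (Suc g # \<gamma>') = wmon (a # js)"
        using IH(4) 2 ks \<gamma> by (simp add: single_add[of _ 1 g, simplified] add.assoc flip: IH(4))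
      ultimately show ?thesis
        using IH 2 ks \<gamma> by (intro exI[of _ ks] exI[of _ "Suc g # \<gamma>'"]) auto
    qed
  qed
qed

text \<open>Each index is repeated over its block. The inclusion of \<open>set js\<close> in
  \<open>set ks\<close> is carried along so that later indices are known to exceed the first
  one.\<close>

lemma fits_imp_sorted_zip:
  fixes ks :: "'v::linorder list" and w :: "'a::linorder list"
  assumes "fits \<gamma> w" "length ks = length \<gamma>" "sorted_wrt (<) ks"
  shows "\<exists>js. length js = length w \<and> sorted_wrt (<) (zip js w) \<and> wmon js = expo ks \<gamma> \<and> set js \<subseteq> set ks"
  using assms
proof (induction \<gamma> arbitrary: w ks)
  case (Cons g \<gamma>)
  obtain k ks' where ks: "ks = k # ks'"
    using Cons.prems by (cases ks) auto
  have g: "0 < g" "g \<le> length w" "sorted_wrt (<) (take g w)" "fits \<gamma> (drop g w)"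
    using Cons.prems by auto
  obtain js where js: "length js = length (drop g w)" "sorted_wrt (<) (zip js (drop g w))"
      "wmon js = expo ks' \<gamma>" "set js \<subseteq> set ks'"
    using Cons.IH[OF g(4), of ks'] Cons.prems ks by auto
  have "zip (replicate g k @ js) w = zip (replicate g k @ js) (take g w @ drop g w)"
    by simp
  also have "\<dots> = map (Pair k) (take g w) @ zip js (drop g w)"
    using g by (subst zip_append) (auto simp: zip_replicate1)
  finally have "zip (replicate g k @ js) w = map (Pair k) (take g w) @ zip js (drop g w)" .
  moreover have "(\<lambda>x y. (k, x) < (k, y)) = ((<) :: 'a \<Rightarrow> 'a \<Rightarrow> bool)"
    by (simp add: fun_eq_iff less_prod_def)
  ultimately have "sorted_wrt (<) (zip (replicate g k @ js) w)"
    using g js Cons.prems(3) ks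
    by (auto simp: sorted_wrt_append sorted_wrt_map dest!: set_zip_leftD)
  then show ?case
    using g js ks by (intro exI[of _ "replicate g k @ js"]) auto
qed auto

text \<open>The expansion of a fundamental function by weakly increasing index sequences that rise
  strictly wherever the word does not; the lexicographic order on pairs encodes both conditions.
  Such a sequence is sorted, hence determined by its monomial, and the count is 0 or 1.\<close>

lemma coef_GF:
  "coef (GF w) m = of_nat (card {js. length js = length w \<and> sorted_wrt (<) (zip js w) \<and> wmon js = m})"
proof (cases "fits (exps m) w")
  case True
  then obtain js where js: "length js = length w" "sorted_wrt (<) (zip js w)" "wmon js = m"
    using fits_imp_sorted_zip[OF True, of "vars m"] expo_vars_exps[of m]
    by (auto simp: exps_def vars_def)
  have "js' = js" if "length js' = length w" "sorted_wrt (<) (zip js' w)" "wmon js' = m" for js'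
    using that js by (metis properties_for_sort sorted_wrt_zip_imp_sorted wmon_eq_iff)
  then have "{js. length js = length w \<and> sorted_wrt (<) (zip js w) \<and> wmon js = m} = {js}"
    using js by blast
  then show ?thesis
    using True by (simp add: coef_GF_exps)
next
  case False
  have "wmon js \<noteq> m" if js: "length js = length w" "sorted_wrt (<) (zip js w)" for js
  proof
    assume m: "wmon js = m"
    obtain ks \<gamma> where "length ks = length \<gamma>" "sorted_wrt (<) ks" "fits \<gamma> w" "expo ks \<gamma> = m"
      using sorted_zip_imp_fits[OF js] m by auto
    then show False
      using False expo_eq_imp(2)[of ks \<gamma> m] fits_imp_Comp[of \<gamma> w] by (auto simp: Comp_iff)
  qed
  then have "{js. length js = length w \<and> sorted_wrt (<) (zip js w) \<and> wmon js = m} = {}"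
    by blast
  then show ?thesis
    using False by (simp only: coef_GF_exps) simp
qed

section \<open>Products and standardization\<close>

text \<open>The product of the functions of the blocks. The base case disregards leftover letters,
  so the intended use is with \<open>\<gamma>\<close> a composition of the length of
  \<open>w\<close>.\<close>

fun GP :: "nat list \<Rightarrow> 'a::linorder list \<Rightarrow> nat series" where
  "GP [] w = 1"
| "GP (g # \<gamma>) w = GF (take g w) * GP \<gamma> (drop g w)"

lemma finite_wmon: "finite {js. wmon js = m}"
proof (cases "\<exists>ks. wmon ks = m")
  case True
  then obtain ks where "wmon ks = m" ..
  then have "{js. wmon js = m} \<subseteq> {js. set js \<subseteq> set ks \<and> length js = length ks}"
    by (auto simp: wmon_eq_iff dest: mset_eq_length) (metis mset_eq_setD)
  then show ?thesis
    by (rule finite_subset) (rule finite_lists_length_eq, simp)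
qed simp

text \<open>A term of the product chooses one index sequence per block. Their concatenation is
  constrained only inside the blocks, which is what it means for \<open>\<gamma>\<close> to fit the
  word of pairs.\<close>

lemma coef_GP:
  "\<gamma> \<in> Comp (length w) \<Longrightarrow>
    coef (GP \<gamma> w) m = of_nat (card {js. length js = length w \<and> fits \<gamma> (zip js w) \<and> wmon js = m})"
proof (induction \<gamma> arbitrary: w m)
  case Nil
  then have "{js. length js = length w \<and> fits [] (zip js w) \<and> wmon js = m} = (if m = 0 then {[]} else {})"
    by (auto simp: Comp_iff)
  then show ?case
    by (simp add: coef_1)
next
  case (Cons g \<gamma>)
  have g: "g \<le> length w" "0 < g" and \<gamma>: "\<gamma> \<in> Comp (length (drop g w))"
    using Cons.prems by (auto simp: Comp_iff)
  define A where "A = (\<lambda>a. {js :: nat list. length js = g \<and> sorted_wrt (<) (zip js (take g w)) \<and> wmon js = a})"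
  define B where "B = (\<lambda>b. {js :: nat list. length js = length w - g \<and> fits \<gamma> (zip js (drop g w)) \<and> wmon js = b})"
  have fin: "finite (A a)" "finite (B b)" for a b
    by (rule finite_subset[OF _ finite_wmon[of a]], auto simp: A_def)
      (rule finite_subset[OF _ finite_wmon[of b]], auto simp: B_def)
  have "coef (GP (g # \<gamma>) w) m = (\<Sum>(a, b)\<in>{(a, b). a + b = m}. of_nat (card (A a \<times> B b)))"
    unfolding GP.simps times_series.rep_eq
    using g by (intro sum.cong) (auto simp: coef_GF Cons.IH[OF \<gamma>] A_def B_def min_def card_cartesian_product)
  also have "\<dots> = (\<Sum>p\<in>{(a, b). a + b = m}. of_nat (card (A (fst p) \<times> B (snd p))))"
    by (simp add: case_prod_unfold)
  also have "\<dots> = of_nat (card (SIGMA p:{(a, b). a + b = m}. A (fst p) \<times> B (snd p)))"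
    using fin finite_splits[of m] by (subst card_SigmaI) simp_all
  also have "card (SIGMA p:{(a, b). a + b = m}. A (fst p) \<times> B (snd p)) =
      card {js. length js = length w \<and> fits (g # \<gamma>) (zip js w) \<and> wmon js = m}" (is "card ?L = card ?R")
  \<comment> \<open>The bijection concatenates the two sequences and is undone by cutting after
    \<open>g\<close> entries; the pair of exponent vectors is recovered from the two pieces.\<close>
  proof (rule bij_betw_same_card[where f = "\<lambda>(p, (js, ks)). js @ ks"],
      rule bij_betw_byWitness[where f' = "\<lambda>js. ((wmon (take g js), wmon (drop g js)), (take g js, drop g js))"])
    show "(\<lambda>(p, (js, ks)). js @ ks) ` ?L \<subseteq> ?R"
    proof (rule image_subsetI)
      fix x assume "x \<in> ?L"
      then obtain js ks where x: "x = ((wmon js, wmon ks), (js, ks))" "js \<in> A (wmon js)"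
          "ks \<in> B (wmon ks)" "wmon js + wmon ks = m"
        by (auto simp: A_def B_def)
      then show "(\<lambda>(p, (js, ks)). js @ ks) x \<in> ?R"
        using g by (simp add: A_def B_def take_zip drop_zip)
    qed
    show "(\<lambda>js. ((wmon (take g js), wmon (drop g js)), (take g js, drop g js))) ` ?R \<subseteq> ?L"
    proof (rule image_subsetI)
      fix js assume "js \<in> ?R"
      moreover have "wmon (take g js) + wmon (drop g js) = wmon js"
        by (simp flip: wmon_append)
      ultimately show "((wmon (take g js), wmon (drop g js)), (take g js, drop g js)) \<in> ?L"
        using g by (simp add: A_def B_def take_zip drop_zip)
    qed
  qed (auto simp: A_def B_def)
  finally show ?case .
qed

section \<open>Standardization of words with distinct letters\<close>

definition word :: "nat \<Rightarrow> (nat \<Rightarrow> 'a) \<Rightarrow> 'a list" where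
  "word n \<sigma> = map \<sigma> [1..<Suc n]"

lemma length_word [simp]: "length (word n \<sigma>) = n"
  by (simp add: word_def)

lemma nth_word [simp]: "i < n \<Longrightarrow> word n \<sigma> ! i = \<sigma> (Suc i)"
  by (simp add: word_def del: upt_Suc)

definition order_iso :: "'a::linorder list \<Rightarrow> 'b::linorder list \<Rightarrow> bool" where
  "order_iso u z \<longleftrightarrow> length u = length z \<and>
    (\<forall>i<length u. \<forall>j<length u. u ! i < u ! j \<longleftrightarrow> z ! i < z ! j)"

lemma fits_order_iso:
  assumes "order_iso u z"
  shows "fits \<gamma> u \<longleftrightarrow> fits \<gamma> z"
proof (cases "\<gamma> \<in> Comp (length u)")
  case True
  have "u ! (i - 1) < u ! i \<longleftrightarrow> z ! (i - 1) < z ! i" if "i \<in> {1..<length u}" for i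
  proof -
    have "i - 1 < length u" "i < length u"
      using that by auto
    then show ?thesis
      using assms unfolding order_iso_def by blast
  qed
  moreover have "length z = length u"
    using assms by (simp add: order_iso_def)
  ultimately show ?thesis
    using True by (simp add: fits_iff_psums)
next
  case False
  then show ?thesis
    using assms fits_imp_Comp unfolding order_iso_def by metis
qed

lemma finite_Sym [simp]: "finite (Sym n)"
  unfolding Sym_def by (rule finite_permutations) simp

lemma Sym_in_image: "\<sigma> \<in> Sym n \<Longrightarrow> \<sigma> p \<in> {1..n} \<longleftrightarrow> p \<in> {1..n}"
  unfolding Sym_def by (simp only: mem_Collect_eq permutes_in_image)

text \<open>The positions whose letter is at most the one at \<open>p\<close> are mapped by
  \<open>\<sigma>\<close> bijectively onto \<open>{1..\<sigma> p}\<close>. Counting them gives a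
  formula in \<open>z\<close> alone, hence uniqueness of the standardization.\<close>

lemma standardization_eq_rank:
  assumes "\<sigma> \<in> Sym n" "length z = n" "order_iso (word n \<sigma>) z" "p \<in> {1..n}"
  shows "\<sigma> p = card {j. j < n \<and> z ! j \<le> z ! (p - 1)}"
proof -
  have \<sigma>: "\<sigma> permutes {1..n}"
    using assms(1) by (simp add: Sym_def)
  have le: "\<sigma> (Suc j) \<le> \<sigma> p \<longleftrightarrow> z ! j \<le> z ! (p - 1)" if "j < n" for j
  proof -
    have "p - 1 < n"
      using assms(4) by auto
    then have "\<sigma> (Suc (p - 1)) < \<sigma> (Suc j) \<longleftrightarrow> z ! (p - 1) < z ! j"
      using assms(3) that by (simp add: order_iso_def)
    then show ?thesis
      using assms(4) by (auto simp: not_less[symmetric])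
  qed
  have "(\<lambda>j. \<sigma> (Suc j)) ` {j. j < n \<and> z ! j \<le> z ! (p - 1)} = {1..\<sigma> p}"
  proof (intro equalityI subsetI)
    fix x assume "x \<in> (\<lambda>j. \<sigma> (Suc j)) ` {j. j < n \<and> z ! j \<le> z ! (p - 1)}"
    then show "x \<in> {1..\<sigma> p}"
      using le Sym_in_image[OF assms(1)] by fastforce
  next
    fix x assume x: "x \<in> {1..\<sigma> p}"
    then have "x \<in> {1..n}"
      using Sym_in_image[OF assms(1), of p] assms(4) by auto
    then have "inv \<sigma> x \<in> {1..n}" "\<sigma> (inv \<sigma> x) = x"
      using permutes_in_image[OF permutes_inv[OF \<sigma>]] permutes_inverses[OF \<sigma>] by auto
    moreover from this obtain j where "inv \<sigma> x = Suc j" "j < n"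
      by (cases "inv \<sigma> x") auto
    ultimately show "x \<in> (\<lambda>j. \<sigma> (Suc j)) ` {j. j < n \<and> z ! j \<le> z ! (p - 1)}"
      using le[of j] x by (intro image_eqI[of _ _ j]) auto
  qed
  moreover have "inj_on (\<lambda>j. \<sigma> (Suc j)) {j. j < n \<and> z ! j \<le> z ! (p - 1)}"
    by (rule inj_onI) (simp add: inj_eq[OF permutes_inj[OF \<sigma>]])
  ultimately show ?thesis
    using card_image by fastforce
qed

lemma standardization_unique:
  assumes "\<sigma> \<in> Sym n" "\<tau> \<in> Sym n" "length z = n" "order_iso (word n \<sigma>) z" "order_iso (word n \<tau>) z"
  shows "\<sigma> = \<tau>"
proof
  fix p
  show "\<sigma> p = \<tau> p"
  proof (cases "p \<in> {1..n}")
    case True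
    then show ?thesis
      using standardization_eq_rank[OF assms(1,3,4)] standardization_eq_rank[OF assms(2,3,5)] by simp
  next
    case False
    then show ?thesis
      using assms(1,2) by (simp add: Sym_def permutes_not_in)
  qed
qed

lemma standardization_exists:
  fixes z :: "'a::linorder list"
  assumes "distinct z" "length z = n"
  obtains \<sigma> where "\<sigma> \<in> Sym n" "order_iso (word n \<sigma>) z"
proof
  \<comment> \<open>The rank counts the letter itself and so starts at 1, as the values of a
    permutation of \<open>{1..n}\<close> must.\<close>
  define r where "r = (\<lambda>i. card {j. j < n \<and> z ! j \<le> z ! i})"
  define \<sigma> where "\<sigma> = (\<lambda>p. if p \<in> {1..n} then r (p - 1) else p)"
  have mono: "r i < r j" if "i < n" "j < n" "z ! i < z ! j" for i j
    unfolding r_def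
  proof (rule psubset_card_mono)
    have "j \<notin> {k. k < n \<and> z ! k \<le> z ! i}"
      using that by auto
    moreover have "j \<in> {k. k < n \<and> z ! k \<le> z ! j}"
      using that by simp
    moreover have "{k. k < n \<and> z ! k \<le> z ! i} \<subseteq> {k. k < n \<and> z ! k \<le> z ! j}"
      using that by auto
    ultimately show "{k. k < n \<and> z ! k \<le> z ! i} \<subset> {k. k < n \<and> z ! k \<le> z ! j}"
      by blast
  qed simp
  have less_iff: "r i < r j \<longleftrightarrow> z ! i < z ! j" if "i < n" "j < n" for i j
    using that mono[of i j] mono[of j i]
    by (cases "z ! i" "z ! j" rule: linorder_cases) (auto simp: r_def)
  have "inj_on \<sigma> {1..n}"
  proof (rule inj_onI)
    fix p q assume pq: "p \<in> {1..n}" "q \<in> {1..n}" "\<sigma> p = \<sigma> q"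
    then have "p - 1 < n" "q - 1 < n"
      by auto
    then have "z ! (p - 1) = z ! (q - 1)"
      using mono[of "p - 1" "q - 1"] mono[of "q - 1" "p - 1"]
      pq
      by (cases "z ! (p - 1)" "z ! (q - 1)" rule: linorder_cases) (auto simp: \<sigma>_def)
    then have "p - 1 = q - 1"
      using assms pq by (subst (asm) nth_eq_iff_index_eq) auto
    then show "p = q"
      using pq by auto
  qed
  moreover have "\<sigma> ` {1..n} \<subseteq> {1..n}"
  proof (rule image_subsetI)
    fix p assume p: "p \<in> {1..n}"
    have "p - 1 \<in> {j. j < n \<and> z ! j \<le> z ! (p - 1)}"
      using p by auto
    then have "0 < r (p - 1)"
      unfolding r_def by (subst card_gt_0_iff) auto
    moreover have "r (p - 1) \<le> card {..<n}"
      unfolding r_def by (rule card_mono) auto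
    ultimately show "\<sigma> p \<in> {1..n}"
      using p by (auto simp: \<sigma>_def)
  qed
  ultimately have "bij_betw \<sigma> {1..n} {1..n}"
    by (simp add: bij_betw_def endo_inj_surj)
  then show "\<sigma> \<in> Sym n"
    unfolding Sym_def mem_Collect_eq by (rule bij_imp_permutes) (auto simp: \<sigma>_def)
  show "order_iso (word n \<sigma>) z"
    using less_iff assms by (auto simp: order_iso_def \<sigma>_def)
qed

text \<open>Positions of words are counted from \<open>0\<close>, but \<open>Sym n\<close> acts on \<open>{1..n}\<close>.\<close>

definition shift_perm :: "(nat \<Rightarrow> nat) \<Rightarrow> nat \<Rightarrow> nat" where
  "shift_perm \<rho> i = \<rho> (Suc i) - 1"

text \<open>No bound on \<open>i\<close> appears: beyond the range \<open>\<rho>\<close> fixes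
  \<open>Suc i\<close>, so the value is positive there too and the truncated subtraction loses
  nothing.\<close>

lemma Suc_shift_perm: "\<rho> \<in> Sym n \<Longrightarrow> Suc (shift_perm \<rho> i) = \<rho> (Suc i)"
  using Sym_in_image[of \<rho> n "Suc i"] unfolding shift_perm_def Sym_def
  by (cases "Suc i \<in> {1..n}") (auto simp: permutes_not_in)

lemma inv_in_Sym [simp]: "\<rho> \<in> Sym n \<Longrightarrow> inv \<rho> \<in> Sym n"
  by (simp add: Sym_def permutes_inv)

lemma shift_perm_permutes: "\<rho> \<in> Sym n \<Longrightarrow> shift_perm \<rho> permutes {..<n}"
proof (rule bij_imp_permutes)
  assume \<rho>: "\<rho> \<in> Sym n"
  then have p: "\<rho> permutes {1..n}"
    by (simp add: Sym_def)
  have lt: "shift_perm \<tau> i < n" if "\<tau> \<in> Sym n" "i < n" for \<tau> i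
    using Sym_in_image[OF that(1), of "Suc i"] that(2) by (auto simp: shift_perm_def)
  have "shift_perm (inv \<rho>) (shift_perm \<rho> i) = i" "shift_perm \<rho> (shift_perm (inv \<rho>) i) = i" for i
    using Suc_shift_perm[OF \<rho>, of i] Suc_shift_perm[OF inv_in_Sym[OF \<rho>], of i] permutes_inverses[OF p]
    by (metis diff_Suc_1 shift_perm_def)+
  then show "bij_betw (shift_perm \<rho>) {..<n} {..<n}"
    using lt \<rho> by (intro bij_betw_byWitness[where f' = "shift_perm (inv \<rho>)"]) auto
  show "shift_perm \<rho> i = i" if "i \<notin> {..<n}" for i
    using permutes_not_in[OF p, of "Suc i"] that by (simp add: shift_perm_def)
qed

text \<open>The letter at position \<open>p\<close> moves to position \<open>\<sigma> p\<close>; the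
  inverse arises because the new word is described by where its letters come from.\<close>

definition act :: "(nat \<Rightarrow> nat) \<Rightarrow> 'a list \<Rightarrow> 'a list" where
  "act \<sigma> w = permute_list (shift_perm (inv \<sigma>)) w"

lemma length_act [simp]: "length (act \<sigma> w) = length w"
  by (simp add: act_def)

lemma nth_act: "i < length w \<Longrightarrow> act \<sigma> w ! i = w ! shift_perm (inv \<sigma>) i"
  by (simp add: act_def permute_list_def)

lemma act_word:
  assumes "\<sigma> \<in> Sym n"
  shows "act \<sigma> (word n \<pi>) = word n (\<pi> \<circ> inv \<sigma>)"
proof (rule nth_equalityI)
  fix i assume "i < length (act \<sigma> (word n \<pi>))"
  then have "i < n" "shift_perm (inv \<sigma>) i < n"
    using permutes_in_image[OF shift_perm_permutes[OF inv_in_Sym[OF assms]], of i] by auto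
  then show "act \<sigma> (word n \<pi>) ! i = word n (\<pi> \<circ> inv \<sigma>) ! i"
    using Suc_shift_perm[OF inv_in_Sym[OF assms], of i] by (simp add: nth_act)
qed simp

text \<open>Since \<open>\<sigma>\<close> prescribes the new positions, the rearranged word
  increases exactly when the letters are ordered like the values of \<open>\<sigma>\<close>.
  Standardizing a word is thus the same as sorting it.\<close>

lemma sorted_act_iff:
  assumes "\<sigma> \<in> Sym n" "length z = n"
  shows "sorted_wrt (<) (act \<sigma> z) \<longleftrightarrow> order_iso (word n \<sigma>) z"
proof -
  define f where "f = shift_perm (inv \<sigma>)"
  have \<sigma>: "\<sigma> permutes {1..n}"
    using assms by (simp add: Sym_def)
  have f_less: "f i < n" if "i < n" for i
    using permutes_in_image[OF shift_perm_permutes[OF inv_in_Sym[OF assms(1)]], of i] that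
    by (simp add: f_def)
  have \<sigma>f: "\<sigma> (Suc (f i)) = Suc i" for i
    unfolding f_def Suc_shift_perm[OF inv_in_Sym[OF assms(1)]] using permutes_inverses[OF \<sigma>] by simp
  have onto: "\<exists>i'<n. f i' = i" if "i < n" for i
    using permutes_image[OF shift_perm_permutes[OF inv_in_Sym[OF assms(1)]]] that
    unfolding f_def by (metis (no_types, lifting) imageE lessThan_iff)
  have "order_iso (word n \<sigma>) z \<longleftrightarrow>
      (\<forall>i<n. \<forall>j<n. \<sigma> (Suc i) < \<sigma> (Suc j) \<longleftrightarrow> z ! i < z ! j)"
    using assms(2) by (simp add: order_iso_def)
  \<comment> \<open>\<open>f\<close> runs through all positions and undoes \<open>\<sigma>\<close>,
    so this reparametrization turns the values of \<open>\<sigma>\<close> into plain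
    indices.\<close>
  also have "\<dots> \<longleftrightarrow> (\<forall>i<n. \<forall>j<n. \<sigma> (Suc (f i)) < \<sigma> (Suc (f j)) \<longleftrightarrow> z ! f i < z ! f j)"
    using f_less onto by metis
  also have "\<dots> \<longleftrightarrow> (\<forall>i<n. \<forall>j<n. i < j \<longleftrightarrow> z ! f i < z ! f j)"
    by (simp add: \<sigma>f)
  also have "\<dots> \<longleftrightarrow> (\<forall>i j. i < j \<longrightarrow> j < n \<longrightarrow> z ! f i < z ! f j)"
  proof
    assume *: "\<forall>i j. i < j \<longrightarrow> j < n \<longrightarrow> z ! f i < z ! f j"
    have "i < j \<longleftrightarrow> z ! f i < z ! f j" if "i < n" "j < n" for i j
      using * that by (cases i j rule: linorder_cases) (simp_all add: less_not_sym)
    then show "\<forall>i<n. \<forall>j<n. i < j \<longleftrightarrow> z ! f i < z ! f j"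
      by blast
  qed (meson less_trans)
  also have "\<dots> \<longleftrightarrow> sorted_wrt (<) (act \<sigma> z)"
    using assms(2) by (auto simp: sorted_wrt_iff_nth_less nth_act f_def)
  finally show ?thesis ..
qed

text \<open>Permuting the indices together with the letters sorts the word of pairs and leaves the
  monomial unchanged; permuting back is the inverse map.\<close>

lemma card_standardization_class:
  assumes "\<sigma> \<in> Sym n" "length w = n"
  shows "card {js :: nat list. length js = n \<and> order_iso (word n \<sigma>) (zip js w) \<and> wmon js = m} =
    card {js. length js = n \<and> sorted_wrt (<) (zip js (act \<sigma> w)) \<and> wmon js = m}" (is "card ?L = card ?R")
proof -
  define f where "f = shift_perm (inv \<sigma>)"
  have f: "f permutes {..<n}"
    unfolding f_def using assms by (intro shift_perm_permutes inv_in_Sym)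
  have zip: "sorted_wrt (<) (zip (permute_list f js) (act \<sigma> w)) \<longleftrightarrow> order_iso (word n \<sigma>) (zip js w)"
    if "length js = n" for js :: "nat list"
    using sorted_act_iff[OF assms(1), of "zip js w"] permute_list_zip[OF f, of js w] that assms(2)
    by (simp add: act_def f_def)
  have wmon: "wmon (permute_list f js) = wmon js" if "length js = n" for js :: "nat list"
    using mset_permute_list[of f js] f that by (simp add: wmon_eq_iff)
  have inv: "permute_list f (permute_list (inv f) js) = js" "permute_list (inv f) (permute_list f js) = js"
    if "length js = n" for js :: "nat list"
    using permute_list_compose[of f js "inv f"] permute_list_compose[of "inv f" js f] f
      permutes_inv[OF f] permutes_inv_o[OF f] that by (simp_all)
  have "bij_betw (permute_list f) ?L ?R"
  proof (rule bij_betw_byWitness[where f' = "permute_list (inv f)"])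
    show "permute_list f ` ?L \<subseteq> ?R"
      using zip wmon by auto
    show "permute_list (inv f) ` ?R \<subseteq> ?L"
    proof (rule image_subsetI)
      fix js assume js: "js \<in> ?R"
      then show "permute_list (inv f) js \<in> ?L"
        using zip[of "permute_list (inv f) js"] wmon[of "permute_list (inv f) js"] inv[of js] by simp
    qed
  qed (use inv in auto)
  then show ?thesis
    by (rule bij_betw_same_card)
qed

text \<open>
  A monomial of the left-hand side is an index sequence \<open>js\<close>; ordering the pairs (index, letter)
  lexicographically, the unique standardization of \<open>zip js w\<close> tells to which \<open>\<sigma>\<close> it belongs.
\<close>

lemma GP_eq_sum:
  assumes "\<gamma> \<in> Comp n" "length w = n" "distinct w"
  shows "GP \<gamma> w = (\<Sum>\<sigma> | \<sigma> \<in> Sym n \<and> fits \<gamma> (word n \<sigma>). GF (act \<sigma> w))"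
proof (rule series_eqI)
  fix m
  define P where "P = {\<sigma> \<in> Sym n. fits \<gamma> (word n \<sigma>)}"
  define R where "R = (\<lambda>\<sigma> :: nat \<Rightarrow> nat. {js :: nat list. length js = n \<and> order_iso (word n \<sigma>) (zip js w) \<and> wmon js = m})"
  have finP: "finite P"
    unfolding P_def by (rule finite_subset[OF _ finite_Sym]) blast
  have finR: "finite (R \<sigma>)" for \<sigma>
    unfolding R_def by (rule finite_subset[OF _ finite_wmon[of m]]) blast
  have "{js. length js = n \<and> fits \<gamma> (zip js w) \<and> wmon js = m} = (\<Union>\<sigma>\<in>P. R \<sigma>)"
  proof (intro equalityI subsetI)
    fix js assume js: "js \<in> {js. length js = n \<and> fits \<gamma> (zip js w) \<and> wmon js = m}"
    then have "distinct (zip js w)" "length (zip js w) = n"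
      using assms by (simp_all add: distinct_zipI2)
    then obtain \<sigma> where \<sigma>: "\<sigma> \<in> Sym n" "order_iso (word n \<sigma>) (zip js w)"
      by (rule standardization_exists)
    then have "\<sigma> \<in> P" "js \<in> R \<sigma>"
      using js fits_order_iso[OF \<sigma>(2)] by (simp_all add: P_def R_def)
    then show "js \<in> (\<Union>\<sigma>\<in>P. R \<sigma>)"
      by blast
  next
    fix js assume "js \<in> (\<Union>\<sigma>\<in>P. R \<sigma>)"
    then obtain \<sigma> where \<sigma>: "\<sigma> \<in> P" "js \<in> R \<sigma>"
      by blast
    then show "js \<in> {js. length js = n \<and> fits \<gamma> (zip js w) \<and> wmon js = m}"
      using fits_order_iso[of "word n \<sigma>" "zip js w"] by (simp add: P_def R_def)
  qed
  moreover have "card (\<Union>\<sigma>\<in>P. R \<sigma>) = (\<Sum>\<sigma>\<in>P. card (R \<sigma>))"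
  proof (rule card_UN_disjoint)
    have "\<sigma> = \<tau>" if "\<sigma> \<in> P" "\<tau> \<in> P" "js \<in> R \<sigma>" "js \<in> R \<tau>" for \<sigma> \<tau> js
      by (rule standardization_unique[of \<sigma> n \<tau> "zip js w"])
        (use that assms in \<open>simp_all add: P_def R_def\<close>)
    then show "\<forall>\<sigma>\<in>P. \<forall>\<tau>\<in>P. \<sigma> \<noteq> \<tau> \<longrightarrow> R \<sigma> \<inter> R \<tau> = {}"
      by blast
  qed (simp_all add: finP finR)
  ultimately have "coef (GP \<gamma> w) m = (\<Sum>\<sigma>\<in>P. of_nat (card (R \<sigma>)))"
    using assms by (simp add: coef_GP)
  also have "\<dots> = (\<Sum>\<sigma>\<in>P. coef (GF (act \<sigma> w)) m)"
    using assms by (intro sum.cong) (simp_all add: P_def R_def coef_GF card_standardization_class)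
  finally show "coef (GP \<gamma> w) m = coef (\<Sum>\<sigma> | \<sigma> \<in> Sym n \<and> fits \<gamma> (word n \<sigma>). GF (act \<sigma> w)) m"
    by (simp add: P_def)
qed

section \<open>The coproduct\<close>

lemma map_key_join:
  fixes a :: "'v \<Rightarrow>\<^sub>0 nat" and b :: "'w \<Rightarrow>\<^sub>0 nat"
  obtains m where "Poly_Mapping.map_key Inl m = a" "Poly_Mapping.map_key Inr m = b"
proof
  let ?h = "case_sum (Poly_Mapping.lookup a) (Poly_Mapping.lookup b)"
  have "{x. ?h x \<noteq> 0} \<subseteq> Inl ` Poly_Mapping.keys a \<union> Inr ` Poly_Mapping.keys b"
  proof
    fix x assume "x \<in> {x. ?h x \<noteq> 0}"
    then show "x \<in> Inl ` Poly_Mapping.keys a \<union> Inr ` Poly_Mapping.keys b"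
      by (cases x) (auto simp: in_keys_iff)
  qed
  then have "finite {x. ?h x \<noteq> 0}"
    by (rule finite_subset) simp
  then have "Poly_Mapping.lookup (Abs_poly_mapping ?h) = ?h"
    by (rule lookup_Abs_poly_mapping)
  then show "Poly_Mapping.map_key Inl (Abs_poly_mapping ?h) = a"
    and "Poly_Mapping.map_key Inr (Abs_poly_mapping ?h) = b"
    by (auto intro!: poly_mapping_eqI simp: map_key.rep_eq)
qed

text \<open>The monomial in two alphabets with prescribed parts. A choice suffices, as only its two
  restrictions are ever used.\<close>

definition join_mon :: "('v \<Rightarrow>\<^sub>0 nat) \<Rightarrow> ('w \<Rightarrow>\<^sub>0 nat) \<Rightarrow> ('v + 'w) \<Rightarrow>\<^sub>0 nat" where
  "join_mon a b = (SOME m. Poly_Mapping.map_key Inl m = a \<and> Poly_Mapping.map_key Inr m = b)"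

lemma map_key_join_mon [simp]:
  "Poly_Mapping.map_key Inl (join_mon a b) = a" "Poly_Mapping.map_key Inr (join_mon a b) = b"
proof -
  have "\<exists>m. Poly_Mapping.map_key Inl m = a \<and> Poly_Mapping.map_key Inr m = b"
    by (meson map_key_join)
  then have "Poly_Mapping.map_key Inl (join_mon a b) = a \<and> Poly_Mapping.map_key Inr (join_mon a b) = b"
    unfolding join_mon_def by (rule someI_ex)
  then show "Poly_Mapping.map_key Inl (join_mon a b) = a" "Poly_Mapping.map_key Inr (join_mon a b) = b"
    by simp_all
qed

lemma coef_tensor_join [simp]: "coef (f \<otimes>\<^sub>q g) (join_mon a b) = coef f a * coef g b"
  by (simp add: coef_tensor)

lemma inj_QM_tensor: "inj_on (\<lambda>(\<beta>, \<gamma>). QM \<beta> \<otimes>\<^sub>q QM \<gamma>) (Comps \<times> Comps)"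
  and independent_QM_tensor: "series.independent ((\<lambda>(\<beta>, \<gamma>). QM \<beta> \<otimes>\<^sub>q QM \<gamma>) ` (Comps \<times> Comps))"
  by (rule independent_family_dual[where m = "\<lambda>(\<beta>, \<gamma>). join_mon (std_mon \<beta>) (std_mon \<gamma>)"];
      auto simp: coef_QM_std_mon)+

lemma finite_cuts: "finite {(\<beta>, \<gamma>). \<beta> @ \<gamma> = \<alpha>}"
proof (rule finite_subset)
  show "{(\<beta>, \<gamma>). \<beta> @ \<gamma> = \<alpha>} \<subseteq> (\<lambda>i. (take i \<alpha>, drop i \<alpha>)) ` {..length \<alpha>}"
  proof
    fix p assume "p \<in> {(\<beta>, \<gamma>). \<beta> @ \<gamma> = \<alpha>}"
    then have "p = (take (length (fst p)) \<alpha>, drop (length (fst p)) \<alpha>)" "length (fst p) \<le> length \<alpha>"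
      by auto
    then show "p \<in> (\<lambda>i. (take i \<alpha>, drop i \<alpha>)) ` {..length \<alpha>}"
      by blast
  qed
qed simp

text \<open>Deconcatenation read dually: among all cuts of all basis elements, only the cut of
  \<open>\<beta> @ \<gamma>\<close> into \<open>\<beta>\<close> and \<open>\<gamma>\<close>
  contributes to this monomial.\<close>

lemma coef_coproduct:
  assumes "f \<in> QSym" "\<beta> \<in> Comps" "\<gamma> \<in> Comps"
  shows "coef (coproduct f) (join_mon (std_mon \<beta>) (std_mon \<gamma>)) = coef f (std_mon (\<beta> @ \<gamma>))"
proof -
  obtain A r where A: "finite A" "A \<subseteq> Comps" "f = (\<Sum>\<alpha>\<in>A. r \<alpha> *\<^sub>q QM \<alpha>)"
    using assms(1) unfolding QSym_def by (rule span_image_expansion)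
  have "coef (\<Sum>(\<beta>', \<gamma>') | \<beta>' @ \<gamma>' = \<alpha>. QM \<beta>' \<otimes>\<^sub>q QM \<gamma>') (join_mon (std_mon \<beta>) (std_mon \<gamma>)) =
      coef (QM \<alpha>) (std_mon (\<beta> @ \<gamma>))" if "\<alpha> \<in> A" for \<alpha>
  proof -
    have \<alpha>: "\<alpha> \<in> Comps"
      using that A by blast
    have "coef (\<Sum>(\<beta>', \<gamma>') | \<beta>' @ \<gamma>' = \<alpha>. QM \<beta>' \<otimes>\<^sub>q QM \<gamma>') (join_mon (std_mon \<beta>) (std_mon \<gamma>)) =
        (\<Sum>p | (case p of (\<beta>', \<gamma>') \<Rightarrow> \<beta>' @ \<gamma>' = \<alpha>). if p = (\<beta>, \<gamma>) then 1 else 0)"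
      unfolding coef_sum using \<alpha> assms by (intro sum.cong) (auto simp: coef_QM_std_mon)
    also have "\<dots> = of_bool (\<beta> @ \<gamma> = \<alpha>)"
      using finite_cuts[of \<alpha>] by simp
    finally show ?thesis
      using \<alpha> assms by (auto simp: coef_QM_std_mon)
  qed
  then show ?thesis
    unfolding A(3) coproduct_def lin_extend_sum[OF inj_QM independent_QM A(1,2)] by simp
qed

lemma coproduct_GF:
  "coproduct (GF w) = (\<Sum>(\<beta>, \<gamma>) | fits (\<beta> @ \<gamma>) w. QM \<beta> \<otimes>\<^sub>q QM \<gamma>)"
  and finite_fits_cuts: "finite {(\<beta>, \<gamma>). fits (\<beta> @ \<gamma>) w}"
proof -
  have "{(\<beta>, \<gamma>). fits (\<beta> @ \<gamma>) w} = (\<Union>\<alpha>\<in>{\<alpha>. fits \<alpha> w}. {(\<beta>, \<gamma>). \<beta> @ \<gamma> = \<alpha>})"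
    by auto
  then show fin: "finite {(\<beta>, \<gamma>). fits (\<beta> @ \<gamma>) w}"
    by (simp add: finite_cuts del: UN_simps)
  have "GF w = (\<Sum>\<alpha> | fits \<alpha> w. 1 *\<^sub>q QM \<alpha>)"
    by (simp add: GF_def)
  then have "coproduct (GF w) = (\<Sum>\<alpha> | fits \<alpha> w. 1 *\<^sub>q (\<Sum>(\<beta>, \<gamma>) | \<beta> @ \<gamma> = \<alpha>. QM \<beta> \<otimes>\<^sub>q QM \<gamma>))"
    unfolding coproduct_def
    by (simp only:, intro lin_extend_sum inj_QM independent_QM)
      (auto simp: Comp_iff dest: fits_imp_Comp)
  also have "\<dots> = (\<Sum>\<alpha> | fits \<alpha> w. \<Sum>p | p \<in> {(\<beta>, \<gamma>). fits (\<beta> @ \<gamma>) w} \<and> (case p of (\<beta>, \<gamma>) \<Rightarrow> \<beta> @ \<gamma>) = \<alpha>.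
      case p of (\<beta>, \<gamma>) \<Rightarrow> QM \<beta> \<otimes>\<^sub>q QM \<gamma>)"
    by (intro sum.cong) (auto intro!: sum.cong)
  also have "\<dots> = (\<Sum>(\<beta>, \<gamma>) | fits (\<beta> @ \<gamma>) w. QM \<beta> \<otimes>\<^sub>q QM \<gamma>)"
    by (rule sum.group[OF fin]) auto
  finally show "coproduct (GF w) = (\<Sum>(\<beta>, \<gamma>) | fits (\<beta> @ \<gamma>) w. QM \<beta> \<otimes>\<^sub>q QM \<gamma>)" .
qed

lemma tensor_map_coproduct_GF:
  "tensor_map \<Phi> (coproduct (GF w)) = (\<Sum>(\<beta>, \<gamma>) | fits (\<beta> @ \<gamma>) w. \<Phi> (QM \<beta>) \<otimes>\<^sub>q \<Phi> (QM \<gamma>))"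
proof -
  have "coproduct (GF w) = (\<Sum>p | (case p of (\<beta>, \<gamma>) \<Rightarrow> fits (\<beta> @ \<gamma>) w). 1 *\<^sub>q (case p of (\<beta>, \<gamma>) \<Rightarrow> QM \<beta> \<otimes>\<^sub>q QM \<gamma>))"
    by (simp add: coproduct_GF)
  then have "tensor_map \<Phi> (coproduct (GF w)) =
      (\<Sum>p | (case p of (\<beta>, \<gamma>) \<Rightarrow> fits (\<beta> @ \<gamma>) w). 1 *\<^sub>q (case p of (\<beta>, \<gamma>) \<Rightarrow> \<Phi> (QM \<beta>) \<otimes>\<^sub>q \<Phi> (QM \<gamma>)))"
    unfolding tensor_map_def
    by (simp only:, intro lin_extend_sum inj_QM_tensor independent_QM_tensor finite_fits_cuts)
      (auto simp: Comp_iff dest!: fits_imp_Comp)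
  then show ?thesis
    by simp
qed

section \<open>Hopf endomorphisms\<close>

context
  fixes \<Phi> assumes \<Phi>: "\<Phi> \<in> End_QSym"
begin

lemma End_QSym_deg: "f \<in> QSym_deg n \<Longrightarrow> \<Phi> f \<in> QSym_deg n"
  using \<Phi> unfolding End_QSym_def by blast

lemma End_zero: "\<Phi> 0 = 0"
proof -
  have "0 \<in> QSym"
    unfolding QSym_def by (rule series.span_zero)
  then have "\<Phi> (0 *\<^sub>q 0) = 0 *\<^sub>q \<Phi> 0"
    using \<Phi> unfolding End_QSym_def by blast
  then show ?thesis
    by simp
qed

lemma End_sum: "(\<And>i. i \<in> A \<Longrightarrow> f i \<in> QSym) \<Longrightarrow> \<Phi> (\<Sum>i\<in>A. f i) = (\<Sum>i\<in>A. \<Phi> (f i))"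
proof (induction A rule: infinite_finite_induct)
  case (insert x A)
  then have "(\<Sum>i\<in>A. f i) \<in> QSym"
    unfolding QSym_def by (intro series.span_sum) auto
  moreover have "\<Phi> (f + g) = \<Phi> f + \<Phi> g" if "f \<in> QSym" "g \<in> QSym" for f g
    using that \<Phi> unfolding End_QSym_def by blast
  ultimately show ?case
    using insert by simp
qed (simp_all add: End_zero)

lemma End_GF: "\<Phi> (GF w) = (\<Sum>\<gamma> | fits \<gamma> w. \<Phi> (QM \<gamma>))"
  unfolding GF_def
  by (rule End_sum) (use QM_in_QSym_deg QSym_deg_subset fits_imp_Comp in blast)

text \<open>By \<open>coef_coproduct\<close> the left side is a coefficient of the coproduct, which
  \<open>\<Phi>\<close> respects. As \<open>\<Phi>\<close> preserves degrees, only cuts whose first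
  component has size \<open>g\<close> survive; these are independent choices for the prefix and the
  suffix of \<open>w\<close>, so the sum factors.\<close>

lemma coef_End_GF_Cons:
  assumes "g # \<gamma> \<in> Comp (length w)"
  shows "coef (\<Phi> (GF w)) (std_mon (g # \<gamma>)) =
    coef (\<Phi> (GF (take g w))) (Poly_Mapping.single 0 g) * coef (\<Phi> (GF (drop g w))) (std_mon \<gamma>)"
proof -
  have g: "0 < g" "g \<le> length w" "\<gamma> \<in> Comps"
    using assms by (auto simp: Comp_iff)
  have GF: "GF w \<in> QSym" "\<Phi> (GF w) \<in> QSym"
    using GF_in_QSym_deg End_QSym_deg QSym_deg_subset by blast+
  define h where "h = (\<lambda>(\<beta>, \<delta>). coef (\<Phi> (QM \<beta>)) (std_mon [g]) * coef (\<Phi> (QM \<delta>)) (std_mon \<gamma>))"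
  have zero: "coef (\<Phi> (QM \<beta>)) (std_mon [g]) = 0" if "\<beta> \<in> Comps" "sum_list \<beta> \<noteq> g" for \<beta>
    using that g by (intro coef_QSym_deg_neq[of _ "sum_list \<beta>"] End_QSym_deg QM_in_QSym_deg) (auto simp: Comp_iff)
  have sum_g: "sum_list \<beta> = g" if "fits \<beta> (take g w)" for \<beta>
    using fits_imp_Comp[OF that] g by (simp add: Comp_iff min_absorb2)
  have "coef (\<Phi> (GF w)) (std_mon (g # \<gamma>)) = coef (\<Phi> (GF w)) (std_mon ([g] @ \<gamma>))"
    by simp
  also have "\<dots> = coef (coproduct (\<Phi> (GF w))) (join_mon (std_mon [g]) (std_mon \<gamma>))"
    using g GF by (subst coef_coproduct) auto
  also have "coproduct (\<Phi> (GF w)) = tensor_map \<Phi> (coproduct (GF w))"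
    using \<Phi> GF unfolding End_QSym_def by blast
  also have "coef \<dots> (join_mon (std_mon [g]) (std_mon \<gamma>)) = sum h {(\<beta>, \<delta>). fits (\<beta> @ \<delta>) w}"
    unfolding tensor_map_coproduct_GF coef_sum h_def by (intro sum.cong) auto
  also have "\<dots> = sum h ({\<beta>. fits \<beta> (take g w)} \<times> {\<delta>. fits \<delta> (drop g w)})"
  proof (rule sum.mono_neutral_right[OF finite_fits_cuts])
    show "{\<beta>. fits \<beta> (take g w)} \<times> {\<delta>. fits \<delta> (drop g w)} \<subseteq> {(\<beta>, \<delta>). fits (\<beta> @ \<delta>) w}"
      using g sum_g by (auto simp: fits_append)
    show "\<forall>p\<in>{(\<beta>, \<delta>). fits (\<beta> @ \<delta>) w} - {\<beta>. fits \<beta> (take g w)} \<times> {\<delta>. fits \<delta> (drop g w)}. h p = 0"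
    proof
      fix p assume p: "p \<in> {(\<beta>, \<delta>). fits (\<beta> @ \<delta>) w} - {\<beta>. fits \<beta> (take g w)} \<times> {\<delta>. fits \<delta> (drop g w)}"
      then obtain \<beta> \<delta> where \<beta>\<delta>: "p = (\<beta>, \<delta>)" "fits (\<beta> @ \<delta>) w"
        by auto
      then have "\<beta> \<in> Comps"
        using fits_imp_Comp[of "\<beta> @ \<delta>" w] by (simp add: Comp_iff)
      moreover have "sum_list \<beta> \<noteq> g"
        using p \<beta>\<delta> by (auto simp: fits_append)
      ultimately show "h p = 0"
        using zero \<beta>\<delta> by (simp add: h_def)
    qed
  qed
  also have "\<dots> = (\<Sum>\<beta> | fits \<beta> (take g w). coef (\<Phi> (QM \<beta>)) (std_mon [g])) *
      (\<Sum>\<delta> | fits \<delta> (drop g w). coef (\<Phi> (QM \<delta>)) (std_mon \<gamma>))"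
    by (simp add: h_def sum_product sum.cartesian_product)
  also have "\<dots> = coef (\<Phi> (GF (take g w))) (std_mon [g]) * coef (\<Phi> (GF (drop g w))) (std_mon \<gamma>)"
    by (simp add: End_GF)
  also have "std_mon [g] = Poly_Mapping.single 0 g"
    by (simp add: std_mon_def)
  finally show ?thesis .
qed

text \<open>The degree of the product is read off its expansion into the functions
  \<open>GF (act \<sigma> w)\<close>, all homogeneous of the length of \<open>w\<close>.\<close>

lemma GP_in_QSym_deg:
  assumes "\<gamma> \<in> Comp (length w)" "distinct w"
  shows "GP \<gamma> w \<in> QSym_deg (length w)"
  unfolding GP_eq_sum[OF assms(1) refl assms(2)] QSym_deg_def
  using GF_in_QSym_deg[of "act _ w"] by (intro series.span_sum) (simp add: QSym_deg_def)

text \<open>The counterpart of \<open>coef_End_GF_Cons\<close> on the side of the product: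
  \<open>\<Phi>\<close> is multiplicative, and so is reading off powers of \<open>x_0\<close> by
  \<open>coef_single_mult\<close>.\<close>

lemma coef_End_GP_Cons:
  assumes "g # \<gamma> \<in> Comp (length w)" "distinct w"
  shows "coef (\<Phi> (GP (g # \<gamma>) w)) (Poly_Mapping.single 0 (length w)) =
    coef (\<Phi> (GF (take g w))) (Poly_Mapping.single 0 g) *
    coef (\<Phi> (GP \<gamma> (drop g w))) (Poly_Mapping.single 0 (length w - g))"
proof -
  have g: "g \<le> length w" "\<gamma> \<in> Comp (length (drop g w))"
    using assms by (auto simp: Comp_iff)
  have 1: "GF (take g w) \<in> QSym_deg g"
    using GF_in_QSym_deg[of "take g w"] g by (simp add: min_absorb2)
  have 2: "GP \<gamma> (drop g w) \<in> QSym_deg (length w - g)"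
    using GP_in_QSym_deg[OF g(2)] assms(2) by simp
  have "\<Phi> (GP (g # \<gamma>) w) = \<Phi> (GF (take g w)) * \<Phi> (GP \<gamma> (drop g w))"
    using \<Phi> 1 2 QSym_deg_subset unfolding End_QSym_def GP.simps by blast
  then show ?thesis
    using coef_single_mult[OF End_QSym_deg[OF 1] End_QSym_deg[OF 2]] g by simp
qed

text \<open>Coproduct and product meet here: both sides split off the same factor for the first
  block, the left by deconcatenation and the right by multiplicativity.\<close>

lemma coef_End_GF:
  "\<gamma> \<in> Comp (length w) \<Longrightarrow> distinct w \<Longrightarrow>
    coef (\<Phi> (GF w)) (std_mon \<gamma>) = coef (\<Phi> (GP \<gamma> w)) (Poly_Mapping.single 0 (length w))"
proof (induction \<gamma> arbitrary: w)
  case Nil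
  have "GF w = 1"
    using Nil by (simp add: Comp_iff GF_Nil)
  then show ?case
    using Nil by (simp add: Comp_iff std_mon_def)
next
  case (Cons g \<gamma>)
  then have "\<gamma> \<in> Comp (length (drop g w))"
    by (auto simp: Comp_iff)
  with Cons show ?case
    by (simp add: coef_End_GF_Cons coef_End_GP_Cons del: GP.simps)
qed

text \<open>Compared at each \<open>std_mon \<gamma>\<close>. There the left side is a coefficient
  of \<open>\<Phi> (GP \<gamma> (word n \<pi>))\<close>, which \<open>GP_eq_sum\<close> turns into a
  sum over those \<open>\<sigma>\<close> whose word \<open>\<gamma>\<close> fits; this condition is
  also the coefficient of \<open>GF (word n \<sigma>)\<close>.\<close>

lemma End_GF_expansion:
  assumes "\<pi> \<in> Sym n"
  shows "\<Phi> (GF (word n \<pi>)) =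
    (\<Sum>\<sigma>\<in>Sym n. coef (\<Phi> (GF (word n (\<pi> \<circ> inv \<sigma>)))) (Poly_Mapping.single 0 n) *\<^sub>q GF (word n \<sigma>))"
proof (rule QSym_deg_eqI)
  have GF: "GF (word n \<sigma>) \<in> QSym_deg n" for \<sigma> :: "nat \<Rightarrow> nat"
    using GF_in_QSym_deg[of "word n \<sigma>"] by simp
  then show "\<Phi> (GF (word n \<pi>)) \<in> QSym_deg n"
    by (rule End_QSym_deg)
  show "(\<Sum>\<sigma>\<in>Sym n. coef (\<Phi> (GF (word n (\<pi> \<circ> inv \<sigma>)))) (Poly_Mapping.single 0 n) *\<^sub>q GF (word n \<sigma>))
      \<in> QSym_deg n"
    using GF unfolding QSym_deg_def by (intro series.span_sum series.span_scale)
  fix \<gamma> assume \<gamma>: "\<gamma> \<in> Comp n"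
  have dist: "distinct (word n \<pi>)"
    using assms permutes_inj_on[of \<pi>] by (auto simp: word_def distinct_map Sym_def simp del: upt_Suc)
  have "GF (word n \<sigma>) \<in> QSym" for \<sigma> :: "nat \<Rightarrow> nat"
    using GF QSym_deg_subset by blast
  then have End: "\<Phi> (GP \<gamma> (word n \<pi>)) =
      (\<Sum>\<sigma> | \<sigma> \<in> Sym n \<and> fits \<gamma> (word n \<sigma>). \<Phi> (GF (word n (\<pi> \<circ> inv \<sigma>))))"
    unfolding GP_eq_sum[OF \<gamma> length_word dist]
    by (subst End_sum) (auto simp: act_word)
  have "coef (\<Phi> (GF (word n \<pi>))) (std_mon \<gamma>) = coef (\<Phi> (GP \<gamma> (word n \<pi>))) (Poly_Mapping.single 0 n)"
    using coef_End_GF[of \<gamma> "word n \<pi>"] \<gamma> dist by simp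
  also have "\<dots> = (\<Sum>\<sigma>\<in>Sym n. coef (\<Phi> (GF (word n (\<pi> \<circ> inv \<sigma>)))) (Poly_Mapping.single 0 n) *
      of_bool (fits \<gamma> (word n \<sigma>)))"
    unfolding End coef_sum by (rule sum.mono_neutral_cong_left) auto
  also have "\<dots> = coef (\<Sum>\<sigma>\<in>Sym n. coef (\<Phi> (GF (word n (\<pi> \<circ> inv \<sigma>)))) (Poly_Mapping.single 0 n) *\<^sub>q
      GF (word n \<sigma>)) (std_mon \<gamma>)"
    using \<gamma> by (simp add: coef_GF_exps Comp_iff)
  finally show "coef (\<Phi> (GF (word n \<pi>))) (std_mon \<gamma>) =
    coef (\<Sum>\<sigma>\<in>Sym n. coef (\<Phi> (GF (word n (\<pi> \<circ> inv \<sigma>)))) (Poly_Mapping.single 0 n) *\<^sub>q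
      GF (word n \<sigma>)) (std_mon \<gamma>)" .
qed

text \<open>The component of degree one is the line through \<open>QM [1]\<close>, so a scalar
  exists; it is unique because \<open>QM [1]\<close> has coefficient 1 at \<open>x_0\<close>. This
  justifies the definite description in \<open>lam\<close>.\<close>

lemma coef_End_QM_one: "coef (\<Phi> (QM [1])) (Poly_Mapping.single 0 1) = lam \<Phi>"
proof -
  have Comp1: "Comp 1 = {[1]}"
  proof (intro equalityI subsetI)
    fix \<gamma> assume "\<gamma> \<in> Comp 1"
    then show "\<gamma> \<in> {[1]}"
      by (cases \<gamma>; cases "tl \<gamma>") (auto simp: Comp_iff)
  qed (simp add: Comp_iff)
  have "QM [1] \<in> QSym_deg 1"
    by (rule QM_in_QSym_deg) (simp add: Comp_iff)
  then have "\<Phi> (QM [1]) \<in> series.span {QM [1]}"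
    using End_QSym_deg[of "QM [1]" 1] unfolding QSym_deg_def Comp1 by simp
  then obtain l where l: "\<Phi> (QM [1]) = l *\<^sub>q QM [1]"
    by (auto simp: series.span_singleton)
  have c: "coef (QM [1]) (Poly_Mapping.single 0 1) = 1"
    using coef_QM_std_mon[of "[1]" "[1]"] by (simp add: std_mon_def)
  have "lam \<Phi> = l"
    unfolding lam_def
  proof (rule the_equality[where P = "\<lambda>l. \<Phi> (QM [1]) = l *\<^sub>q QM [1]"])
    fix l' assume "\<Phi> (QM [1]) = l' *\<^sub>q QM [1]"
    then have "l' *\<^sub>q QM [1] = l *\<^sub>q QM [1]"
      using l by metis
    then have "coef (l' *\<^sub>q QM [1]) (Poly_Mapping.single 0 1) = coef (l *\<^sub>q QM [1]) (Poly_Mapping.single 0 1)"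
      by (rule arg_cong)
    then show "l' = l"
      by (simp only: coef_scale c mult_1_right)
  qed (rule l)
  then show ?thesis
    using l c by simp
qed

text \<open>A block of length one gives \<open>QM [1]\<close> whatever its letter, so each letter
  contributes one factor \<open>lam \<Phi>\<close>.\<close>

lemma coef_End_GP_ones:
  "distinct w \<Longrightarrow>
    coef (\<Phi> (GP (replicate (length w) 1) w)) (Poly_Mapping.single 0 (length w)) = lam \<Phi> ^ length w"
proof (induction w)
  case Nil
  have "\<Phi> 1 = 1"
    using \<Phi> unfolding End_QSym_def by blast
  then show ?case
    by (simp add: coef_1)
next
  case (Cons x w)
  have "{\<gamma>. fits \<gamma> [x]} = {[1]}"
  proof (intro equalityI subsetI)
    fix \<gamma> assume "\<gamma> \<in> {\<gamma>. fits \<gamma> [x]}"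
    then show "\<gamma> \<in> {[1]}"
      using fits_imp_Comp[of \<gamma> "[x]"] by (cases \<gamma>; cases "tl \<gamma>") (auto simp: Comp_iff)
  qed simp
  then have "GF [x] = QM [1]"
    by (simp add: GF_def)
  then show ?case
    using Cons coef_End_GP_Cons[of 1 "replicate (length w) 1" "x # w"] coef_End_QM_one
    by (simp add: Comp_iff Comps_iff sum_list_replicate)
qed

text \<open>The composition with all parts 1 fits every word, so for the identity word
  \<open>GP_eq_sum\<close> runs over the whole group. It produces the inverse permutations, and
  inversion reindexes the sum.\<close>

lemma sum_Sym_coef_End_GF:
  "(\<Sum>\<sigma>\<in>Sym n. coef (\<Phi> (GF (word n \<sigma>))) (Poly_Mapping.single 0 n)) = lam \<Phi> ^ n"
proof -
  have fits: "fits (replicate (length w) 1) w" for w :: "nat list"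
    by (induction w) (auto simp: take_Cons')
  have ones: "replicate n 1 \<in> Comp n"
    by (simp add: Comp_iff Comps_iff sum_list_replicate)
  have dist: "distinct (word n id)"
    by (simp add: word_def distinct_map del: upt_Suc)
  have "GF (word n \<sigma>) \<in> QSym" for \<sigma> :: "nat \<Rightarrow> nat"
    using GF_in_QSym_deg[of "word n \<sigma>"] QSym_deg_subset by auto
  then have "\<Phi> (GP (replicate n 1) (word n id)) = (\<Sum>\<sigma>\<in>Sym n. \<Phi> (GF (word n (inv \<sigma>))))"
    unfolding GP_eq_sum[OF ones length_word dist] using fits[of "word n _"]
    by (subst End_sum) (auto simp: act_word)
  then have "lam \<Phi> ^ n = (\<Sum>\<sigma>\<in>Sym n. coef (\<Phi> (GF (word n (inv \<sigma>)))) (Poly_Mapping.single 0 n))"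
    using coef_End_GP_ones[OF dist] by simp
  also have "\<dots> = (\<Sum>\<sigma>\<in>Sym n. coef (\<Phi> (GF (word n \<sigma>))) (Poly_Mapping.single 0 n))"
    unfolding Sym_def by (rule sum_permutations_inverse[symmetric])
  finally show ?thesis ..
qed

end

section \<open>Descents and the lumping\<close>

lemma Des_subset: "Des n \<sigma> \<subseteq> {1..<n}"
  by (auto simp: Des_def)

lemma descomp_in_Comp: "descomp n \<sigma> \<in> Comp n"
  unfolding descomp_def by (rule co_in_Comp[OF Des_subset])

lemma psums_descomp: "psums (descomp n \<sigma>) = Des n \<sigma>"
  unfolding descomp_def by (rule psums_co[OF Des_subset])

lemma sum_list_Comp: "\<alpha> \<in> Comp n \<Longrightarrow> sum_list \<alpha> = n"
  by (simp add: Comp_iff)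

lemma fits_word_iff:
  assumes "\<sigma> \<in> Sym n"
  shows "fits \<gamma> (word n \<sigma>) \<longleftrightarrow> \<gamma> \<in> Comp n \<and> Des n \<sigma> \<subseteq> psums \<gamma>"
proof (cases "\<gamma> \<in> Comp n")
  case True
  \<comment> \<open>Injectivity ensures that neighbours without an ascent form a descent.\<close>
  have neq: "\<sigma> i \<noteq> \<sigma> (i + 1)" for i
    using assms permutes_inj[of \<sigma>] by (auto simp: Sym_def inj_eq)
  have "fits \<gamma> (word n \<sigma>) \<longleftrightarrow> (\<forall>i\<in>{1..<n}. i \<notin> psums \<gamma> \<longrightarrow> \<sigma> i < \<sigma> (i + 1))"
  proof -
    have "word n \<sigma> ! (i - 1) = \<sigma> i" "word n \<sigma> ! i = \<sigma> (i + 1)" if "i \<in> {1..<n}" for i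
      using that by (cases i; simp)+
    then show ?thesis
      using True by (simp add: fits_iff_psums)
  qed
  also have "\<dots> \<longleftrightarrow> Des n \<sigma> \<subseteq> psums \<gamma>"
    using neq by (fastforce simp: Des_def not_less_iff_gr_or_eq)
  finally show ?thesis
    using True by simp
qed (use fits_imp_Comp[of \<gamma> "word n \<sigma>"] in auto)

lemma GF_word: "\<sigma> \<in> Sym n \<Longrightarrow> GF (word n \<sigma>) = QF (descomp n \<sigma>)"
  unfolding GF_def QF_def comp_le_def psums_descomp sum_list_Comp[OF descomp_in_Comp]
  by (simp only: fits_word_iff)

text \<open>Makes every row of \<open>Kbar\<close> accessible through a permutation. The permutation
  is the standardization of a word built to descend exactly at the partial sums.\<close>

lemma descomp_surj:
  assumes "\<alpha> \<in> Comp n"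
  obtains \<sigma> where "\<sigma> \<in> Sym n" "descomp n \<sigma> = \<alpha>"
proof -
  define c where "c = (\<lambda>i. card {s \<in> psums \<alpha>. s \<le> i})"
  have fin: "finite (psums \<alpha>)"
    using psums_subset[OF assms] finite_subset by blast
  have c_Suc: "c (Suc i) = (if Suc i \<in> psums \<alpha> then Suc (c i) else c i)" for i
  proof -
    have "{s \<in> psums \<alpha>. s \<le> Suc i} =
        (if Suc i \<in> psums \<alpha> then insert (Suc i) {s \<in> psums \<alpha>. s \<le> i} else {s \<in> psums \<alpha>. s \<le> i})"
      by (auto simp: le_Suc_eq)
    then show ?thesis
      using fin by (simp add: c_def)
  qed
  \<comment> \<open>\<open>c i\<close> numbers the block containing position \<open>i\<close>. With
    the sign reversed each block lies below the preceding one, while the second component increases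
    inside a block and keeps the letters distinct.\<close>
  define z where "z = map (\<lambda>i. (- int (c i), i)) [0..<n]"
  have "distinct z" "length z = n"
    by (simp_all add: z_def distinct_map inj_on_def)
  then obtain \<sigma> where \<sigma>: "\<sigma> \<in> Sym n" "order_iso (word n \<sigma>) z"
    by (rule standardization_exists)
  have "\<sigma> (i + 1) < \<sigma> i \<longleftrightarrow> i \<in> psums \<alpha>" if "i \<in> {1..<n}" for i
  proof -
    obtain k where k: "i = Suc k"
      using \<open>i \<in> {1..<n}\<close> by (cases i) auto
    have "\<sigma> (i + 1) < \<sigma> i \<longleftrightarrow> z ! i < z ! k"
      using \<sigma>(2) that by (auto simp: order_iso_def k)
    also have "\<dots> \<longleftrightarrow> i \<in> psums \<alpha>"
      using that by (auto simp: z_def k c_Suc less_prod_def)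
    finally show ?thesis .
  qed
  then have "Des n \<sigma> = psums \<alpha>"
    using psums_subset[OF assms] by (fastforce simp: Des_def)
  then have "descomp n \<sigma> = \<alpha>"
    unfolding descomp_def using co_psums[OF assms] by simp
  then show ?thesis
    using \<sigma>(1) that by blast
qed

section \<open>The basis of fundamental functions\<close>

lemma coef_QF:
  assumes "\<alpha> \<in> Comp n" "\<gamma> \<in> Comp n"
  shows "coef (QF \<alpha>) (std_mon \<gamma>) = of_bool (psums \<alpha> \<subseteq> psums \<gamma>)"
proof -
  have "coef (QF \<alpha>) (std_mon \<gamma>) =
      (\<Sum>\<beta> | \<beta> \<in> Comp n \<and> psums \<alpha> \<subseteq> psums \<beta>. if \<beta> = \<gamma> then 1 else 0)"
    unfolding QF_def comp_le_def coef_sum sum_list_Comp[OF assms(1)]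
    using assms by (intro sum.cong) (auto simp: coef_QM_std_mon Comp_iff)
  then show ?thesis
    using assms by simp
qed

text \<open>\<open>QF\<close> is unitriangular with respect to \<open>QM\<close> and inclusion of the sets \<open>psums\<close>.\<close>

lemma inj_QF: "inj_on QF (Comp n)" and independent_QF: "series.independent (QF ` Comp n)"
proof -
  have indep: "\<forall>\<alpha>\<in>A. r \<alpha> = 0"
    if A: "finite A" "A \<subseteq> Comp n" "(\<Sum>\<alpha>\<in>A. r \<alpha> *\<^sub>q QF \<alpha>) = 0" for A r
  proof
    fix \<gamma> assume "\<gamma> \<in> A"
    then show "r \<gamma> = 0"
    proof (induction "card (psums \<gamma>)" arbitrary: \<gamma> rule: less_induct)
      case less
      have "r \<alpha> * coef (QF \<alpha>) (std_mon \<gamma>) = (if \<alpha> = \<gamma> then r \<gamma> else 0)" if "\<alpha> \<in> A" for \<alpha>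
      proof (cases "psums \<alpha> \<subset> psums \<gamma>")
        case True
        moreover have "finite (psums \<gamma>)"
          using psums_subset[of \<gamma> n] less.prems A finite_subset by blast
        ultimately have "r \<alpha> = 0"
          using less.hyps[OF psubset_card_mono] that by blast
        then show ?thesis
          using True by auto
      next
        case False
        then show ?thesis
          using that less.prems A psums_inject[of \<alpha> n \<gamma>] by (subst coef_QF[of _ n]) auto
      qed
      then have "coef (\<Sum>\<alpha>\<in>A. r \<alpha> *\<^sub>q QF \<alpha>) (std_mon \<gamma>) = (\<Sum>\<alpha>\<in>A. if \<alpha> = \<gamma> then r \<gamma> else 0)"
        by simp
      then show ?case
        using A less.prems by simp
    qed
  qed
  show "inj_on QF (Comp n)" and "series.independent (QF ` Comp n)"
    by (rule independent_familyI; rule indep; assumption)+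
qed

section \<open>Entries and row sums of the two matrices\<close>

lemma comp_in_Sym: "\<pi> \<in> Sym n \<Longrightarrow> \<sigma> \<in> Sym n \<Longrightarrow> \<pi> \<circ> \<sigma> \<in> Sym n"
  by (simp add: Sym_def permutes_compose)

text \<open>Grouping \<open>End_GF_expansion\<close> by descent composition gives the coordinates in
  the basis \<open>QF\<close>. At the coefficient of the \<open>n\<close>-th power of
  \<open>x_0\<close> only the coordinate of \<open>one_part n\<close> remains, as no other
  composition of \<open>n\<close> has an empty set of partial sums.\<close>

lemma
  assumes \<Phi>: "\<Phi> \<in> End_QSym" and \<pi>: "\<pi> \<in> Sym n"
  shows cc_descomp: "\<beta> \<in> Comp n \<Longrightarrow> cc \<Phi> (descomp n \<pi>) \<beta> =
      (\<Sum>\<sigma> | \<sigma> \<in> Sym n \<and> descomp n \<sigma> = \<beta>. coef (\<Phi> (GF (word n (\<pi> \<circ> inv \<sigma>)))) (Poly_Mapping.single 0 n))"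
    and cc_descomp_one_part: "cc \<Phi> (descomp n \<pi>) (one_part n) = coef (\<Phi> (GF (word n \<pi>))) (Poly_Mapping.single 0 n)"
proof -
  define d where "d = (\<lambda>\<beta>. \<Sum>\<sigma> | \<sigma> \<in> Sym n \<and> descomp n \<sigma> = \<beta>.
      coef (\<Phi> (GF (word n (\<pi> \<circ> inv \<sigma>)))) (Poly_Mapping.single 0 n))"
  have "\<Phi> (QF (descomp n \<pi>)) =
      (\<Sum>\<sigma>\<in>Sym n. coef (\<Phi> (GF (word n (\<pi> \<circ> inv \<sigma>)))) (Poly_Mapping.single 0 n) *\<^sub>q QF (descomp n \<sigma>))"
    using End_GF_expansion[OF \<Phi> \<pi>] \<pi> by (simp add: GF_word)
  also have "\<dots> = (\<Sum>\<beta>\<in>Comp n. \<Sum>\<sigma> | \<sigma> \<in> Sym n \<and> descomp n \<sigma> = \<beta>.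
      coef (\<Phi> (GF (word n (\<pi> \<circ> inv \<sigma>)))) (Poly_Mapping.single 0 n) *\<^sub>q QF (descomp n \<sigma>))"
    using descomp_in_Comp by (intro sum.group[symmetric]) auto
  also have "\<dots> = (\<Sum>\<beta>\<in>Comp n. d \<beta> *\<^sub>q QF \<beta>)"
    unfolding d_def by (intro sum.cong) (simp_all add: series.scale_sum_left)
  finally have QF: "\<Phi> (QF (descomp n \<pi>)) = (\<Sum>\<beta>\<in>Comp n. d \<beta> *\<^sub>q QF \<beta>)" .
  have cc: "cc \<Phi> (descomp n \<pi>) \<beta> = d \<beta>" if "\<beta> \<in> Comp n" for \<beta>
    unfolding cc_def sum_list_Comp[OF descomp_in_Comp] QF
    using coord_sum[OF inj_QF independent_QF finite_Comp subset_refl that] that by simp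
  then show "\<beta> \<in> Comp n \<Longrightarrow> cc \<Phi> (descomp n \<pi>) \<beta> =
      (\<Sum>\<sigma> | \<sigma> \<in> Sym n \<and> descomp n \<sigma> = \<beta>. coef (\<Phi> (GF (word n (\<pi> \<circ> inv \<sigma>)))) (Poly_Mapping.single 0 n))"
    by (simp add: d_def)
  have empty: "psums (one_part n) = {}"
    by (simp add: one_part_def psums_Cons)
  have "coef (\<Phi> (GF (word n \<pi>))) (Poly_Mapping.single 0 n) =
      coef (\<Sum>\<beta>\<in>Comp n. d \<beta> *\<^sub>q QF \<beta>) (std_mon (one_part n))"
    using \<pi> by (simp only: GF_word QF std_mon_one_part)
  also have "\<dots> = (\<Sum>\<beta>\<in>Comp n. if \<beta> = one_part n then d \<beta> else 0)"
    unfolding coef_sum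
  proof (intro sum.cong refl)
    fix \<beta> assume \<beta>: "\<beta> \<in> Comp n"
    then have "psums \<beta> = {} \<longleftrightarrow> \<beta> = one_part n"
      using psums_inject[OF \<beta> one_part_in_Comp] empty by auto
    then show "coef (d \<beta> *\<^sub>q QF \<beta>) (std_mon (one_part n)) = (if \<beta> = one_part n then d \<beta> else 0)"
      using coef_QF[OF \<beta> one_part_in_Comp] empty by simp
  qed
  also have "\<dots> = cc \<Phi> (descomp n \<pi>) (one_part n)"
    using cc[OF one_part_in_Comp] by simp
  finally show "cc \<Phi> (descomp n \<pi>) (one_part n) = coef (\<Phi> (GF (word n \<pi>))) (Poly_Mapping.single 0 n)" ..
qed

lemma sum_Sym_cc_one_part:
  assumes "\<Phi> \<in> End_QSym"
  shows "(\<Sum>\<sigma>\<in>Sym n. cc \<Phi> (descomp n \<sigma>) (one_part n)) = lam \<Phi> ^ n"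
  using sum_Sym_coef_End_GF[OF assms, of n] assms by (simp add: cc_descomp_one_part)

text \<open>The inverse in the definition of \<open>K\<close> yields
  \<open>\<pi> \<circ> inv \<sigma>\<close>, the permutation that occurs in
  \<open>End_GF_expansion\<close>; the normalizing sum is \<open>lam \<Phi> ^ n\<close>.\<close>

lemma K_eq:
  assumes "\<Phi> \<in> End_QSym" "\<pi> \<in> Sym n" "\<sigma> \<in> Sym n"
  shows "K \<Phi> n \<pi> \<sigma> = cc \<Phi> (descomp n (\<pi> \<circ> inv \<sigma>)) (one_part n) / lam \<Phi> ^ n"
proof -
  have "bij \<pi>" "bij \<sigma>"
    using assms by (auto simp: Sym_def permutes_bij)
  then have "inv (\<sigma> \<circ> inv \<pi>) = \<pi> \<circ> inv \<sigma>"
    by (simp add: o_inv_distrib bij_imp_bij_inv inv_inv_eq)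
  then show ?thesis
    using assms by (simp add: K_def Prob_def sum_Sym_cc_one_part)
qed

text \<open>Up to the common denominator, both sides are the sum in \<open>cc_descomp\<close>. The
  right side sees \<open>\<pi>\<close> only through its descent composition, which is the lumping
  property.\<close>

lemma sum_K_descent_class:
  assumes "\<Phi> \<in> End_QSym" "\<pi> \<in> Sym n" "\<beta> \<in> Comp n"
  shows "(\<Sum>\<sigma> | \<sigma> \<in> Sym n \<and> descomp n \<sigma> = \<beta>. K \<Phi> n \<pi> \<sigma>) = Kbar \<Phi> n (descomp n \<pi>) \<beta>"
  using assms
  by (simp add: Kbar_def cc_descomp[of \<Phi> \<pi> n \<beta>] sum_divide_distrib K_eq cc_descomp_one_part comp_in_Sym)

text \<open>For fixed \<open>\<pi>\<close> the map from \<open>\<sigma>\<close> to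
  \<open>\<pi> \<circ> inv \<sigma>\<close> is a bijection of the group, so a row of
  \<open>K\<close> runs through the whole distribution.\<close>

lemma sum_K_row:
  assumes "\<Phi> \<in> End_QSym" "\<pi> \<in> Sym n" "lam \<Phi> ^ n \<noteq> 0"
  shows "(\<Sum>\<sigma>\<in>Sym n. K \<Phi> n \<pi> \<sigma>) = 1"
proof -
  let ?c = "\<lambda>\<sigma>. cc \<Phi> (descomp n \<sigma>) (one_part n)"
  have "(\<Sum>\<sigma>\<in>Sym n. ?c (\<pi> \<circ> inv \<sigma>)) = (\<Sum>\<sigma>\<in>Sym n. ?c (\<pi> \<circ> \<sigma>))"
    unfolding Sym_def by (rule sum_permutations_inverse[symmetric])
  also have "\<dots> = (\<Sum>\<sigma>\<in>Sym n. ?c \<sigma>)"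
    using assms(2) unfolding Sym_def by (intro setum_permutations_compose_left[symmetric]) simp
  also have "\<dots> = lam \<Phi> ^ n"
    by (rule sum_Sym_cc_one_part[OF assms(1)])
  finally show ?thesis
    using assms by (simp add: K_eq flip: sum_divide_distrib)
qed

theorem theorem3p1:
  fixes n :: nat and \<Phi> :: "nat series \<Rightarrow> nat series"
  assumes "\<Phi> \<in> End_QSym"
    and "\<forall>\<alpha>\<in>Comp n. 0 \<le> cc \<Phi> \<alpha> (one_part n)"
    and "\<exists>\<alpha>\<in>Comp n. cc \<Phi> \<alpha> (one_part n) \<noteq> 0"
  shows "lam \<Phi> ^ n > 0 \<and>
    stochastic_on (Comp n) (Kbar \<Phi> n) \<and>
    (\<forall>\<beta>\<in>Comp n. \<forall>\<pi>\<in>Sym n. \<forall>\<tau>\<in>Sym n. descomp n \<pi> = descomp n \<tau> \<longrightarrow>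
       (\<Sum>\<sigma> | \<sigma> \<in> Sym n \<and> descomp n \<sigma> = \<beta>. K \<Phi> n \<pi> \<sigma>) =
         (\<Sum>\<sigma> | \<sigma> \<in> Sym n \<and> descomp n \<sigma> = \<beta>. K \<Phi> n \<tau> \<sigma>) \<and>
       (\<Sum>\<sigma> | \<sigma> \<in> Sym n \<and> descomp n \<sigma> = \<beta>. K \<Phi> n \<pi> \<sigma>) = Kbar \<Phi> n (descomp n \<pi>) \<beta>)"
proof (intro conjI)
  have nonneg: "0 \<le> cc \<Phi> (descomp n \<sigma>) (one_part n)" for \<sigma>
    using assms(2) descomp_in_Comp by blast
  obtain \<alpha> where \<alpha>: "\<alpha> \<in> Comp n" "cc \<Phi> \<alpha> (one_part n) \<noteq> 0"
    using assms(3) by blast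
  then obtain \<rho> where "\<rho> \<in> Sym n" "descomp n \<rho> = \<alpha>"
    using descomp_surj by blast
  \<comment> \<open>The nonzero coefficient is attained at the permutation \<open>\<rho>\<close>, so
    a sum of nonnegative terms has a positive one.\<close>
  then have "0 < (\<Sum>\<sigma>\<in>Sym n. cc \<Phi> (descomp n \<sigma>) (one_part n))"
    using \<alpha> nonneg by (intro sum_pos2[of _ \<rho>]) (auto simp: order_less_le)
  then show pos: "lam \<Phi> ^ n > 0"
    by (simp add: sum_Sym_cc_one_part assms(1))
  note lump = sum_K_descent_class[OF assms(1)]
  have K_nonneg: "0 \<le> K \<Phi> n \<pi> \<sigma>" if "\<pi> \<in> Sym n" "\<sigma> \<in> Sym n" for \<pi> \<sigma>
    using K_eq[OF assms(1) that] nonneg pos by simp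
  show "stochastic_on (Comp n) (Kbar \<Phi> n)"
    unfolding stochastic_on_def
  proof (intro conjI ballI)
    fix \<alpha> \<beta> assume "\<alpha> \<in> Comp n" "\<beta> \<in> Comp n"
    \<comment> \<open>Any permutation in the descent class of \<open>\<alpha>\<close> may represent
      the row, so nonnegativity is inherited from \<open>K\<close>.\<close>
    obtain \<pi> where \<pi>: "\<pi> \<in> Sym n" "descomp n \<pi> = \<alpha>"
      using \<open>\<alpha> \<in> Comp n\<close> by (rule descomp_surj)
    have "0 \<le> (\<Sum>\<sigma> | \<sigma> \<in> Sym n \<and> descomp n \<sigma> = \<beta>. K \<Phi> n \<pi> \<sigma>)"
      using K_nonneg \<pi> by (intro sum_nonneg) auto
    then show "0 \<le> Kbar \<Phi> n \<alpha> \<beta>"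
      using lump[OF \<pi>(1) \<open>\<beta> \<in> Comp n\<close>] \<pi> by simp
  next
    fix \<alpha> assume "\<alpha> \<in> Comp n"
    then obtain \<pi> where \<pi>: "\<pi> \<in> Sym n" "descomp n \<pi> = \<alpha>"
      by (rule descomp_surj)
    have "(\<Sum>\<beta>\<in>Comp n. Kbar \<Phi> n \<alpha> \<beta>) =
        (\<Sum>\<beta>\<in>Comp n. \<Sum>\<sigma> | \<sigma> \<in> Sym n \<and> descomp n \<sigma> = \<beta>. K \<Phi> n \<pi> \<sigma>)"
      using lump[OF \<pi>(1)] \<pi>(2) by simp
    \<comment> \<open>The descent classes partition the group, so the lumped row sums to the same
      total as the row of \<open>K\<close>.\<close>
    also have "\<dots> = (\<Sum>\<sigma>\<in>Sym n. K \<Phi> n \<pi> \<sigma>)"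
      using descomp_in_Comp by (intro sum.group) auto
    also have "\<dots> = 1"
      using pos by (intro sum_K_row assms(1) \<pi>(1)) (metis less_irrefl)
    finally show "(\<Sum>\<beta>\<in>Comp n. Kbar \<Phi> n \<alpha> \<beta>) = 1" .
  qed
  show "\<forall>\<beta>\<in>Comp n. \<forall>\<pi>\<in>Sym n. \<forall>\<tau>\<in>Sym n. descomp n \<pi> = descomp n \<tau> \<longrightarrow>
       (\<Sum>\<sigma> | \<sigma> \<in> Sym n \<and> descomp n \<sigma> = \<beta>. K \<Phi> n \<pi> \<sigma>) =
         (\<Sum>\<sigma> | \<sigma> \<in> Sym n \<and> descomp n \<sigma> = \<beta>. K \<Phi> n \<tau> \<sigma>) \<and>
       (\<Sum>\<sigma> | \<sigma> \<in> Sym n \<and> descomp n \<sigma> = \<beta>. K \<Phi> n \<pi> \<sigma>) = Kbar \<Phi> n (descomp n \<pi>) \<beta>"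
    by (simp add: lump)
qed

end
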